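(* Let $p$ be a prime and let $k,n$ be nonnegative integers. (1) If $p\equiv 1 \pmod 3$, then \[A_{3}\Big(p^kn+\frac{2p^{k}-2}{3}\Big)=\frac{p^{k}-1}{p-1}A_{3}\Big(pn+\frac{2p-2}{3}\Big)-\frac{p^{k}-p}{p-1}A_{3}(n).\] (2) If $p\equiv 2 \pmod 3$, then \[A_{3}\Big(p^{2k}n+\frac{2p^{2k}-2}{3}\Big)=\frac{p^{2k}-1}{p^2-1}A_{3}\Big(p^2n+\frac{2p^2-2}{3}\Big)-\frac{p^{2k}-p^2}{p^2-1}A_{3}(n).\]
   Context: A partition $\lambda$ of a nonnegative integer is called a $3$-core if none of its hook lengths is divisible by $3$. $A_3(n)$ denotes the number of ordered pairs $(\lambda_1,\lambda_2)$ of partitions, each a $3$-core, whose sizes sum to $n$; equivalently $\sum_{n\ge0}A_3(n)q^n=\frac{(q^3;q^3)_\infty^{6}}{(q;q)_\infty^{2}}$, where $(a;q)_\infty=\prod_{k\ge0}(1-aq^k)$. *)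

theory Defs
  imports Complex_Main "HOL-Computational_Algebra.Primes"
begin

definition is_partition :: "nat list \<Rightarrow> bool" where
  "is_partition xs \<longleftrightarrow> sorted_wrt (\<ge>) xs \<and> 0 \<notin> set xs"

text \<open>Length of the j-th column (0-indexed) of the Young diagram.\<close>
definition conj_part :: "nat list \<Rightarrow> nat \<Rightarrow> nat" where
  "conj_part xs j = length (filter (\<lambda>x. j < x) xs)"

text \<open>Hook length of cell (i,j) (0-indexed, i < length xs, j < xs!i):
  arm + leg + 1.\<close>
definition hook_length :: "nat list \<Rightarrow> nat \<Rightarrow> nat \<Rightarrow> nat" where
  "hook_length xs i j = (xs ! i - j - 1) + (conj_part xs j - i - 1) + 1"

definition is_t_core :: "nat \<Rightarrow> nat list \<Rightarrow> bool" where
  "is_t_core t xs \<longleftrightarrow>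
     (\<forall>i < length xs. \<forall>j < xs ! i. \<not> t dvd hook_length xs i j)"

definition A3 :: "nat \<Rightarrow> nat" where
  "A3 n = card {(l1, l2). is_partition l1 \<and> is_partition l2 \<and>
                          is_t_core 3 l1 \<and> is_t_core 3 l2 \<and>
                          sum_list l1 + sum_list l2 = n}"

end

theory Submission
  imports Defs "HOL-Number_Theory.Number_Theory" "HOL-Library.Discrete_Functions"
begin

text \<open>
  The recurrences follow from \<open>3 A\<^sub>3(n) = \<sigma>(3n + 2)\<close>, since \<open>\<sigma>(p\<^sup>k M)\<close> is of the form \<open>\<alpha> + \<beta> p\<^sup>k\<close>.

  A 3-core is determined by the numbers \<open>a, b\<close> of its first-column hook lengths that are 1 and 2 modulo 3,
  and has size \<open>a\<^sup>2 - ab + b\<^sup>2 + b\<close>. So the 3-cores of \<open>m\<close> correspond to a sixth of the solutions of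
  \<open>x\<^sup>2 + xy + y\<^sup>2 = 3m + 1\<close>, and there are \<open>\<Sum> \<chi>(d)\<close> of them, where \<open>d\<close> runs over the divisors of \<open>3m + 1\<close>
  and \<open>\<chi>\<close> is the nonprincipal character modulo 3. Hence \<open>A\<^sub>3(n)\<close> is the sum of \<open>\<chi>(a) \<chi>(b)\<close> over the positive
  solutions of \<open>ax + by = 3n + 2\<close>. As \<open>\<chi>(a) \<chi>(b) = F(a - b) - F(a + b)\<close> for the indicator function \<open>F\<close> of the
  multiples of 3, Liouville's elementary identity evaluates this sum.
\<close>

section \<open>Divisor sums and the character modulo 3\<close>

lemma nat_mod_3_cases:
  obtains i :: nat where "v = 3 * i" | i where "v = 3 * i + 1" | i where "v = 3 * i + 2"
proof -
  have "v = 3 * (v div 3) \<or> v = 3 * (v div 3) + 1 \<or> v = 3 * (v div 3) + 2" by presburger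
  thus ?thesis using that by blast
qed

text \<open>The divisors of \<open>p * N\<close> are those of \<open>N\<close> together with their
  \<open>p\<close>-multiples, and the overlap consists of \<open>p\<close> times the divisors of
  \<open>N div p\<close>. The ring is left open because both \<open>chi3\<close> and the identity
  are summed.\<close>

lemma sum_divisors_prime_mult:
  fixes g :: "nat \<Rightarrow> 'a::comm_ring_1"
  assumes p: "prime p" and N: "N > 0" and g: "\<And>d. g (p * d) = g p * g d"
  shows "(\<Sum>d | d dvd p * N. g d) = (1 + g p) * (\<Sum>d | d dvd N. g d)
           - g p * (if p dvd N then \<Sum>d | d dvd N div p. g d else 0)"
proof -
  have p0: "p > 0" using p prime_gt_0_nat by blast
  have un: "{d. d dvd p * N} = {d. d dvd N} \<union> (*) p ` {d. d dvd N}"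
  proof (intro equalityI subsetI)
    fix d assume "d \<in> {d. d dvd p * N}"
    hence d: "d dvd p * N" by simp
    show "d \<in> {d. d dvd N} \<union> (*) p ` {d. d dvd N}"
    proof (cases "p dvd d")
      case True
      then obtain e where "d = p * e" by blast
      thus ?thesis using d p0 by auto
    next
      case False
      hence "coprime d p" using p prime_imp_coprime coprime_commute by blast
      thus ?thesis using d coprime_dvd_mult_right_iff by blast
    qed
  qed auto
  have int: "{d. d dvd N} \<inter> (*) p ` {d. d dvd N}
      = (if p dvd N then (*) p ` {d. d dvd N div p} else {})"
    using p0 by (auto elim!: dvdE)
  have fin: "finite {d. d dvd N}" using N by simp
  have inj: "inj_on ((*) p) A" for A using p0 by (auto simp: inj_on_def)
  have img: "(\<Sum>d \<in> (*) p ` A. g d) = g p * (\<Sum>d\<in>A. g d)" for A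
    by (subst sum.reindex[OF inj]) (simp add: g sum_distrib_left)
  have "(\<Sum>d | d dvd p * N. g d) = (\<Sum>d | d dvd N. g d) + g p * (\<Sum>d | d dvd N. g d)
     - (\<Sum>d \<in> {d. d dvd N} \<inter> (*) p ` {d. d dvd N}. g d)"
    unfolding un using fin by (subst sum_Un) (auto simp: img)
  moreover have "(\<Sum>d \<in> {d. d dvd N} \<inter> (*) p ` {d. d dvd N}. g d)
      = g p * (if p dvd N then \<Sum>d | d dvd N div p. g d else 0)"
    unfolding int by (cases "p dvd N") (simp_all only: if_True if_False img sum.empty mult_zero_right)
  ultimately show ?thesis by (simp only: distrib_right mult_1)
qed

definition chi3 :: "nat \<Rightarrow> int" where
  "chi3 n = (if n mod 3 = 1 then 1 else if n mod 3 = 2 then -1 else 0)"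

lemma chi3_mult: "chi3 (m * n) = chi3 m * chi3 n"
proof -
  have red: "chi3 k = chi3 (k mod 3)" for k by (simp add: chi3_def)
  have "chi3 (m * n) = chi3 ((m mod 3) * (n mod 3))" by (simp add: chi3_def mod_mult_eq)
  moreover have "m mod 3 = 0 \<or> m mod 3 = 1 \<or> m mod 3 = 2" "n mod 3 = 0 \<or> n mod 3 = 1 \<or> n mod 3 = 2"
    by presburger+
  ultimately show ?thesis
    unfolding red[of m] red[of n] by (elim disjE) (simp_all add: chi3_def)
qed

text \<open>The involution sending d to N/d reverses the sign of each term, because chi3(d)
  chi3(N/d) = chi3(N) = -1.\<close>

lemma sum_chi3_divisors_eq_0:
  assumes "N mod 3 = 2"
  shows "(\<Sum>d | d dvd N. chi3 d) = 0"
proof -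
  have N0: "N > 0" using assms by (cases N) auto
  have "(\<Sum>d | d dvd N. chi3 d) = (\<Sum>d | d dvd N. chi3 (N div d))"
    by (rule sum.reindex_bij_witness[of _ "\<lambda>d. N div d" "\<lambda>d. N div d"])
       (use N0 in \<open>auto elim!: dvdE\<close>)
  also have "\<dots> = (\<Sum>d | d dvd N. - chi3 d)"
  proof (rule sum.cong)
    fix d assume "d \<in> {d. d dvd N}"
    hence "chi3 N = chi3 d * chi3 (N div d)"
      by (simp flip: chi3_mult)
    thus "chi3 (N div d) = - chi3 d"
      using assms by (auto simp: chi3_def split: if_splits)
  qed simp
  finally show ?thesis by (simp add: sum_negf)
qed

section \<open>Liouville's identity\<close>

definition quad_sols :: "nat \<Rightarrow> (nat \<times> nat \<times> nat \<times> nat) set" where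
  "quad_sols N = {(a, x, b, y). 0 < a \<and> 0 < x \<and> 0 < b \<and> 0 < y \<and> a * x + b * y = N}"

lemma finite_quad_sols: "finite (quad_sols N)"
proof (rule finite_subset)
  show "quad_sols N \<subseteq> {..N} \<times> {..N} \<times> {..N} \<times> {..N}"
  proof
    fix q assume "q \<in> quad_sols N"
    then obtain a x b y where q: "q = (a, x, b, y)"
      and z: "0 < a" "0 < x" "0 < b" "0 < y" "a * x + b * y = N" by (auto simp: quad_sols_def)
    hence "a \<le> a * x" "x \<le> a * x" "b \<le> b * y" "y \<le> b * y" by simp_all
    hence "a \<le> N \<and> x \<le> N \<and> b \<le> N \<and> y \<le> N" using z(5) by linarith
    thus "q \<in> {..N} \<times> {..N} \<times> {..N} \<times> {..N}" by (simp add: q)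
  qed
qed simp

lemma sum_trichotomy:
  fixes u v :: "'a \<Rightarrow> nat"
  assumes "finite S"
  shows "sum f S = sum f {z \<in> S. u z < v z} + sum f {z \<in> S. u z = v z} + sum f {z \<in> S. v z < u z}"
proof -
  have "S = ({z \<in> S. u z < v z} \<union> {z \<in> S. u z = v z}) \<union> {z \<in> S. v z < u z}" by auto
  also have "sum f \<dots> = sum f {z \<in> S. u z < v z} + sum f {z \<in> S. u z = v z} + sum f {z \<in> S. v z < u z}"
    using assms by (subst sum.union_disjoint; (subst sum.union_disjoint)?; auto)
  finally show ?thesis .
qed

text \<open>
  Solutions are moved by the substitutions \<open>ax + by = (a - b)x + b(x + y)\<close> and
  \<open>ax + by = a(x + b) + b(y - a)\<close> and by the exchanges of \<open>b\<close> with \<open>y\<close> and of \<open>(a, x)\<close> with \<open>(b, y)\<close>;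
  everything cancels except the contribution of the diagonals \<open>a = b\<close> and \<open>x = y\<close>.
\<close>
lemma Liouville_identity:
  fixes F :: "int \<Rightarrow> int"
  assumes even: "\<And>x. F (- x) = F x"
  shows "(\<Sum>(a,x,b,y) \<in> quad_sols N. F (int a - int b) - F (int a + int b))
    = (\<Sum>(a,x,b,y) \<in> {(a,x,b,y) \<in> quad_sols N. a = b}. F 0 + 2 * F (int a))
      - (\<Sum>(a,x,b,y) \<in> {(a,x,b,y) \<in> quad_sols N. x = y}. F (int a + int b) + 2 * F (int a))"
proof -
  let ?S = "quad_sols N"
  let ?a = "\<lambda>(a,x,b,y). a :: nat" and ?x = "\<lambda>(a,x,b,y). x :: nat"
  let ?b = "\<lambda>(a,x,b,y). b :: nat" and ?y = "\<lambda>(a,x,b,y). y :: nat"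
  let ?d = "\<lambda>(a,x,b,y). F (int a - int b)" and ?s = "\<lambda>(a,x,b,y). F (int a + int b)"
  let ?f = "\<lambda>(a,x,b,y). F (int a)"
  note fin = finite_quad_sols[of N]
  have even': "F (int a - int b) = F (int b - int a)" for a b
    using even[of "int a - int b"] by simp
  note defs = quad_sols_def
  have 1: "sum ?d {z \<in> ?S. ?a z < ?b z} = sum ?d {z \<in> ?S. ?b z < ?a z}"
    by (rule sum.reindex_bij_witness[of _ "\<lambda>(a,x,b,y). (b,y,a,x)" "\<lambda>(a,x,b,y). (b,y,a,x)"])
       (auto simp: defs algebra_simps even')
  have 2: "sum ?d {z \<in> ?S. ?b z < ?a z} = sum ?f {z \<in> ?S. ?x z < ?y z}"
    by (rule sum.reindex_bij_witness[of _ "\<lambda>(a,x,b,y). (a+b,x,b,y-x)" "\<lambda>(a,x,b,y). (a-b,x,b,x+y)"])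
       (auto simp: defs algebra_simps of_nat_diff elim!: less_natE)
  have 3: "sum ?s {z \<in> ?S. ?x z < ?y z} = sum ?s {z \<in> ?S. ?y z < ?x z}"
    by (rule sum.reindex_bij_witness[of _ "\<lambda>(a,x,b,y). (b,y,a,x)" "\<lambda>(a,x,b,y). (b,y,a,x)"])
       (auto simp: defs algebra_simps)
  have 4: "sum ?s {z \<in> ?S. ?y z < ?x z} = sum ?f {z \<in> ?S. ?b z < ?a z}"
    by (rule sum.reindex_bij_witness[of _ "\<lambda>(a,x,b,y). (b,x+y,a-b,x)" "\<lambda>(a,x,b,y). (a+b,y,a,x-y)"])
       (auto simp: defs algebra_simps of_nat_diff elim!: less_natE)
  have 5: "sum ?f {z \<in> ?S. ?a z < ?y z} = sum ?f {z \<in> ?S. ?b z < ?x z}"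
    by (rule sum.reindex_bij_witness[of _ "\<lambda>(a,x,b,y). (a,x-b,b,y+a)" "\<lambda>(a,x,b,y). (a,x+b,b,y-a)"])
       (auto simp: defs algebra_simps elim!: less_natE)
  have swap: "sum ?f {z \<in> ?S. P (?x z) (?b z)} = sum ?f {z \<in> ?S. P (?x z) (?y z)}"
       "sum ?f {z \<in> ?S. P (?y z) (?a z)} = sum ?f {z \<in> ?S. P (?b z) (?a z)}" for P
    by (rule sum.reindex_bij_witness[of _ "\<lambda>(a,x,b,y). (a,x,y,b)" "\<lambda>(a,x,b,y). (a,x,y,b)"];
        auto simp: defs algebra_simps)+
  \<comment> \<open>Split the sum of F(a) by comparing y with a, and again by comparing x with b. By
    5 the parts a < y and b < x agree, so the rests agree, and exchanging b with y puts them in the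
    stated form.\<close>
  have 6: "sum ?f {z \<in> ?S. ?b z < ?a z} + sum ?f {z \<in> ?S. ?b z = ?a z}
         = sum ?f {z \<in> ?S. ?x z < ?y z} + sum ?f {z \<in> ?S. ?x z = ?y z}"
    using sum_trichotomy[OF fin, of ?f ?y ?a] sum_trichotomy[OF fin, of ?f ?x ?b] 5
      swap(1)[of "(<)"] swap(1)[of "(=)"] swap(2)[of "(<)"] swap(2)[of "(=)"] by linarith
  have 7: "sum ?d ?S = 2 * sum ?f {z \<in> ?S. ?x z < ?y z} + sum ?d {z \<in> ?S. ?a z = ?b z}"
    using sum_trichotomy[OF fin, of ?d ?a ?b] 1 2 by linarith
  have 8: "sum ?s ?S = 2 * sum ?f {z \<in> ?S. ?b z < ?a z} + sum ?s {z \<in> ?S. ?x z = ?y z}"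
    using sum_trichotomy[OF fin, of ?s ?x ?y] 3 4 by linarith
  have 9: "sum ?d ?S - sum ?s ?S
     = (sum ?d {z \<in> ?S. ?a z = ?b z} + 2 * sum ?f {z \<in> ?S. ?b z = ?a z})
      - (sum ?s {z \<in> ?S. ?x z = ?y z} + 2 * sum ?f {z \<in> ?S. ?x z = ?y z})"
    using 6 7 8 by linarith
  have "(\<Sum>(a,x,b,y) \<in> ?S. F (int a - int b) - F (int a + int b)) = sum ?d ?S - sum ?s ?S"
    by (simp add: sum_subtractf case_prod_unfold)
  moreover have "sum ?d {z \<in> ?S. ?a z = ?b z} + 2 * sum ?f {z \<in> ?S. ?b z = ?a z}
     = (\<Sum>(a,x,b,y) \<in> {(a,x,b,y) \<in> ?S. a = b}. F 0 + 2 * F (int a))"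
  proof -
    have "{z \<in> ?S. ?a z = ?b z} = {(a,x,b,y) \<in> ?S. a = b}"
      "{z \<in> ?S. ?b z = ?a z} = {(a,x,b,y) \<in> ?S. a = b}" by auto
    thus ?thesis
      unfolding sum_distrib_left sum.distrib[symmetric] by (auto simp flip: sum.distrib intro!: sum.cong)
  qed
  moreover have "sum ?s {z \<in> ?S. ?x z = ?y z} + 2 * sum ?f {z \<in> ?S. ?x z = ?y z}
     = (\<Sum>(a,x,b,y) \<in> {(a,x,b,y) \<in> ?S. x = y}. F (int a + int b) + 2 * F (int a))"
  proof -
    have "{z \<in> ?S. ?x z = ?y z} = {(a,x,b,y) \<in> ?S. x = y}" by auto
    thus ?thesis
      unfolding sum_distrib_left sum.distrib[symmetric] by (auto simp flip: sum.distrib intro!: sum.cong)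
  qed
  ultimately show ?thesis using 9 by presburger
qed

text \<open>On a = b the equation reads a(x + y) = N, so d = x + y divides N and x is free in
  1..d-1. On x = y it reads (a + b)x = N, with d = a + b and a free.\<close>

lemma sum_quad_sols_diag:
  assumes "N > 0"
  shows "(\<Sum>(a,x,b,y) \<in> {(a,x,b,y) \<in> quad_sols N. a = b}. h a)
      = (\<Sum>d | d dvd N. \<Sum>i\<in>{1..<d}. h (N div d))"
    and "(\<Sum>(a,x,b,y) \<in> {(a,x,b,y) \<in> quad_sols N. x = y}. k a (a + b))
      = (\<Sum>d | d dvd N. \<Sum>i\<in>{1..<d}. k i d)"
proof -
  have fin: "finite {d. d dvd N}" using assms by simp
  have sig: "(\<Sum>d | d dvd N. \<Sum>i\<in>{1..<d}. g d i) = (\<Sum>(d,i)\<in>(SIGMA d:{d. d dvd N}. {1..<d}). g d i)" for g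
    using fin by (simp add: sum.Sigma)
  show "(\<Sum>(a,x,b,y) \<in> {(a,x,b,y) \<in> quad_sols N. a = b}. h a)
      = (\<Sum>d | d dvd N. \<Sum>i\<in>{1..<d}. h (N div d))"
    unfolding sig using assms
    by (intro sum.reindex_bij_witness[of _ "\<lambda>(d,i). (N div d, i, N div d, d - i)" "\<lambda>(a,x,b,y). (x+y,x)"])
       (auto simp: quad_sols_def elim!: dvdE simp flip: distrib_left)
  show "(\<Sum>(a,x,b,y) \<in> {(a,x,b,y) \<in> quad_sols N. x = y}. k a (a + b))
      = (\<Sum>d | d dvd N. \<Sum>i\<in>{1..<d}. k i d)"
    unfolding sig using assms
    by (intro sum.reindex_bij_witness[of _ "\<lambda>(d,i). (i, N div d, d - i, N div d)" "\<lambda>(a,x,b,y). (a+b,a)"])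
       (auto simp: quad_sols_def elim!: dvdE simp flip: distrib_right)
qed

lemma sum_multiples_3: "(\<Sum>i\<in>{1..<d}. of_bool (3 dvd i) :: int) = int ((d - 1) div 3)"
proof -
  have "(\<Sum>i\<in>{1..<Suc d}. of_bool (3 dvd i) :: int) = int (d div 3)" for d
  proof (induction d)
    case (Suc d)
    have "Suc d div 3 = d div 3 + of_bool (3 dvd Suc d)"
      by (cases "3 dvd Suc d") (simp_all, presburger+)
    thus ?case using Suc by (subst sum.atLeastLessThan_Suc) simp_all
  qed simp
  from this[of "d - 1"] show ?thesis by (cases d) simp_all
qed

text \<open>As 3 does not divide N, the terms of Liouville's identity that test a divisor of N for
  divisibility by 3 vanish. What remains counts the numbers below each divisor d and the multiples
  of 3 among them; three times this is d - chi3(d), and the chi3 part sums to 0.\<close>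

lemma sum_quad_sols_chi3:
  assumes N: "N mod 3 = 2"
  shows "3 * (\<Sum>(a,x,b,y) \<in> quad_sols N. chi3 a * chi3 b) = int (\<Sum>d | d dvd N. d)"
proof -
  have N0: "N > 0" using N by (cases N) auto
  define F :: "int \<Rightarrow> int" where "F = (\<lambda>x. of_bool (3 dvd x))"
  have nd: "\<not> 3 dvd d" if "d dvd N" for d using that N dvd_trans[of 3 d N] by auto
  \<comment> \<open>this choice of \<open>F\<close> turns the left-hand side of Liouville's identity into a convolution\<close>
  have chi: "chi3 a * chi3 b = F (int a - int b) - F (int a + int b)" for a b
  proof -
    have "a mod 3 < 3" "b mod 3 < 3" by simp_all
    hence "a mod 3 = 0 \<or> a mod 3 = 1 \<or> a mod 3 = 2" "b mod 3 = 0 \<or> b mod 3 = 1 \<or> b mod 3 = 2" by auto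
    thus ?thesis unfolding chi3_def F_def by (elim disjE; simp; presburger)
  qed
  have Fd: "F (int d) = 0" if "d dvd N" for d
    using nd[OF that] unfolding F_def by (simp add: int_dvd_int_iff[symmetric, of 3, simplified])
  have "(\<Sum>(a,x,b,y) \<in> quad_sols N. chi3 a * chi3 b)
     = (\<Sum>(a,x,b,y) \<in> {(a,x,b,y) \<in> quad_sols N. a = b}. F 0 + 2 * F (int a))
      - (\<Sum>(a,x,b,y) \<in> {(a,x,b,y) \<in> quad_sols N. x = y}. F (int (a + b)) + 2 * F (int a))"
    unfolding chi by (subst Liouville_identity) (auto simp: F_def)
  also have "\<dots> = (\<Sum>d | d dvd N. \<Sum>i\<in>{1..<d}. F 0 + 2 * F (int (N div d)))
      - (\<Sum>d | d dvd N. \<Sum>i\<in>{1..<d}. F (int d) + 2 * F (int i))"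
    by (simp only: sum_quad_sols_diag(1)[OF N0, of "\<lambda>a. F 0 + 2 * F (int a)"]
        sum_quad_sols_diag(2)[OF N0, of "\<lambda>a s. F (int s) + 2 * F (int a)"])
  also have "\<dots> = (\<Sum>d | d dvd N. \<Sum>i\<in>{1..<d}. 1) - (\<Sum>d | d dvd N. \<Sum>i\<in>{1..<d}. 2 * F (int i))"
    by (intro arg_cong2[of _ _ _ _ "(-)"] sum.cong refl)
       (auto simp: Fd F_def[THEN fun_cong, of 0] dvd_div_iff_mult intro!: Fd elim!: dvdE)
  also have "\<dots> = (\<Sum>d | d dvd N. int (d - 1) - 2 * int ((d - 1) div 3))"
  proof -
    have "F (int i) = of_bool (3 dvd i)" for i
      by (simp add: F_def int_dvd_int_iff[symmetric, of 3, simplified])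
    thus ?thesis by (simp only: sum_subtractf sum_multiples_3 flip: sum_distrib_left) simp
  qed
  finally have "3 * (\<Sum>(a,x,b,y) \<in> quad_sols N. chi3 a * chi3 b)
     = (\<Sum>d | d dvd N. 3 * (int (d - 1) - 2 * int ((d - 1) div 3)))"
    by (simp only: sum_distrib_left)
  also have "\<dots> = (\<Sum>d | d dvd N. int d - chi3 d)"
  proof (rule sum.cong)
    fix d assume "d \<in> {d. d dvd N}"
    hence "\<not> 3 dvd d" using nd by simp
    then obtain k where "d = 3 * k + 1 \<or> d = 3 * k + 2"
      by (cases d rule: nat_mod_3_cases) auto
    moreover have "(3 * k + 1) mod 3 = 1" "(3 * k + 2) mod 3 = 2" "(3 * k + 1) div 3 = k" by presburger+
    ultimately show "3 * (int (d - 1) - 2 * int ((d - 1) div 3)) = int d - chi3 d"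
      by (elim disjE) (simp_all add: chi3_def)
  qed simp
  also have "\<dots> = int (\<Sum>d | d dvd N. d)"
    by (simp add: sum_subtractf sum_chi3_divisors_eq_0[OF N])
  finally show ?thesis .
qed

text \<open>A quadruple encodes the splitting A = ax, N - A = by with chosen divisors a and b; x and
  y are the cofactors.\<close>

lemma convolution_divisor_sums:
  fixes g h :: "nat \<Rightarrow> 'a::comm_semiring_0"
  shows "(\<Sum>A\<in>{1..<N}. (\<Sum>d | d dvd A. g d) * (\<Sum>d | d dvd N - A. h d))
    = (\<Sum>(a,x,b,y) \<in> quad_sols N. g a * h b)"
proof -
  have cofactor: "0 < d \<and> 0 < n div d \<and> d * (n div d) = n" if "d dvd n" "0 < n" for d n :: nat
    using that by (auto intro!: Nat.gr0I)
  have "(\<Sum>A\<in>{1..<N}. (\<Sum>d | d dvd A. g d) * (\<Sum>d | d dvd N - A. h d))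
    = (\<Sum>A\<in>{1..<N}. \<Sum>(a,b)\<in>{d. d dvd A} \<times> {d. d dvd N - A}. g a * h b)"
    by (simp add: sum_product sum.cartesian_product)
  also have "\<dots> = (\<Sum>(A,a,b)\<in>(SIGMA A:{1..<N}. {d. d dvd A} \<times> {d. d dvd N - A}). g a * h b)"
    by (subst sum.Sigma) auto
  also have "\<dots> = (\<Sum>(a,x,b,y) \<in> quad_sols N. g a * h b)"
    by (rule sum.reindex_bij_witness[of _ "\<lambda>(a,x,b,y). (a*x,a,b)" "\<lambda>(A,a,b). (a, A div a, b, (N - A) div b)"])
       (auto simp: quad_sols_def cofactor)
  finally show ?thesis .
qed

section \<open>Eisenstein integers of given norm\<close>

text \<open>
  The pair \<open>(x, y)\<close> stands for the Eisenstein integer \<open>x + y\<omega>\<close> with \<open>\<omega> = exp (\<pi>i/3)\<close>,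
  so that \<open>\<omega>\<^sup>2 = \<omega> - 1\<close> and the conjugate of \<open>\<omega>\<close> is \<open>1 - \<omega>\<close>.
\<close>
definition eis_norm :: "int \<times> int \<Rightarrow> int" where
  "eis_norm z = fst z * fst z + fst z * snd z + snd z * snd z"

definition eis_mult :: "int \<times> int \<Rightarrow> int \<times> int \<Rightarrow> int \<times> int" where
  "eis_mult z w = (fst z * fst w - snd z * snd w, fst z * snd w + snd z * fst w + snd z * snd w)"

definition eis_cnj :: "int \<times> int \<Rightarrow> int \<times> int" where
  "eis_cnj z = (fst z + snd z, - snd z)"

definition norm_sols :: "nat \<Rightarrow> (int \<times> int) set" where
  "norm_sols N = {z. eis_norm z = int N}"

lemma eis_norm_mult: "eis_norm (eis_mult z w) = eis_norm z * eis_norm w"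
  by (simp add: eis_norm_def eis_mult_def algebra_simps)

lemma eis_norm_cnj: "eis_norm (eis_cnj z) = eis_norm z"
  by (simp add: eis_norm_def eis_cnj_def algebra_simps)

text \<open>This replaces division by w: multiplying by the conjugate turns the factor w into an
  ordinary integer, which can be cancelled coordinatewise.\<close>

lemma eis_mult_cnj: "eis_mult (eis_cnj w) (eis_mult w z) = eis_mult (eis_norm w, 0) z"
  by (simp add: eis_norm_def eis_cnj_def eis_mult_def algebra_simps)

lemma eis_cnj_cnj [simp]: "eis_cnj (eis_cnj z) = z"
  by (simp add: eis_cnj_def)

text \<open>Completing the square in either variable bounds each coordinate by the norm.\<close>

lemma four_eis_norm: "4 * eis_norm z = (2 * fst z + snd z)\<^sup>2 + 3 * (snd z)\<^sup>2"
   "4 * eis_norm z = (2 * snd z + fst z)\<^sup>2 + 3 * (fst z)\<^sup>2"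
  by (simp_all add: eis_norm_def power2_eq_square algebra_simps)

lemma eis_norm_nonneg: "eis_norm z \<ge> 0"
proof -
  have "0 \<le> 4 * eis_norm z" unfolding four_eis_norm by simp
  thus ?thesis by simp
qed

lemma eis_norm_eq_0: "eis_norm z = 0 \<longleftrightarrow> z = (0, 0)"
proof
  assume "eis_norm z = 0"
  hence "(2 * fst z + snd z)\<^sup>2 + 3 * (snd z)\<^sup>2 = 0" "(2 * snd z + fst z)\<^sup>2 + 3 * (fst z)\<^sup>2 = 0"
    using four_eis_norm[of z] by simp_all
  hence "(snd z)\<^sup>2 = 0" "(fst z)\<^sup>2 = 0"
    using zero_le_power2[of "2 * fst z + snd z"] zero_le_power2[of "snd z"]
      zero_le_power2[of "2 * snd z + fst z"] zero_le_power2[of "fst z"] by linarith+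
  thus "z = (0, 0)" by (simp add: prod_eq_iff)
qed (simp add: eis_norm_def)

lemma finite_norm_sols: "finite (norm_sols N)"
proof (rule finite_subset)
  have le: "\<bar>t\<bar> \<le> 4 * int N" if "t\<^sup>2 \<le> 4 * int N" for t :: int
  proof -
    have "\<bar>t\<bar> \<le> \<bar>t\<bar>\<^sup>2" using self_le_power[of "\<bar>t\<bar>" 2] by (cases "t = 0") auto
    thus ?thesis using that by simp
  qed
  show "norm_sols N \<subseteq> {- 4 * int N..4 * int N} \<times> {- 4 * int N..4 * int N}"
  proof
    fix z assume "z \<in> norm_sols N"
    hence z: "eis_norm z = int N" by (simp add: norm_sols_def)
    have "(snd z)\<^sup>2 \<le> 4 * int N" "(fst z)\<^sup>2 \<le> 4 * int N"
      using four_eis_norm[of z] zero_le_power2[of "2 * fst z + snd z"] zero_le_power2[of "snd z"]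
       zero_le_power2[of "2 * snd z + fst z"] zero_le_power2[of "fst z"] z by linarith+
    from le[OF this(1)] le[OF this(2)]
    show "z \<in> {- 4 * int N..4 * int N} \<times> {- 4 * int N..4 * int N}"
      by (auto simp: mem_Times_iff)
  qed
qed simp

lemma inj_eis_mult:
  assumes "eis_norm w \<noteq> 0"
  shows "inj (eis_mult w)"
proof (rule injI)
  fix u v assume "eis_mult w u = eis_mult w v"
  hence "eis_mult (eis_norm w, 0) u = eis_mult (eis_norm w, 0) v" by (metis eis_mult_cnj)
  thus "u = v" using assms by (simp add: eis_mult_def prod_eq_iff)
qed

text \<open>Removing the factor p divides the norm by p^2, taking \<open>p * N\<close> to
  \<open>N div p\<close>. This count is the correction term of the recursion in
  \<open>card_norm_sols_prime_mult\<close>.\<close>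

lemma card_norm_sols_scaled:
  assumes p: "p > 0"
  shows "card {z \<in> norm_sols (p * N). int p dvd fst z \<and> int p dvd snd z}
      = (if p dvd N then card (norm_sols (N div p)) else 0)"
proof (cases "p dvd N")
  case True
  then obtain M where M: "N = p * M" by blast
  have "{z \<in> norm_sols (p * N). int p dvd fst z \<and> int p dvd snd z} = eis_mult (int p, 0) ` norm_sols M"
  proof (intro equalityI subsetI)
    fix z assume "z \<in> {z \<in> norm_sols (p * N). int p dvd fst z \<and> int p dvd snd z}"
    moreover from this obtain x y where "z = (int p * x, int p * y)"
      by (cases z) (auto elim!: dvdE)
    ultimately have z: "z = eis_mult (int p, 0) (x, y)" and n: "eis_norm z = int (p * N)"
      by (auto simp: norm_sols_def eis_mult_def)
    have "int p * int p * eis_norm (x, y) = int p * int p * int M"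
      using n by (simp add: z M eis_norm_mult, simp add: eis_norm_def)
    hence "eis_norm (x, y) = int M" using p by simp
    thus "z \<in> eis_mult (int p, 0) ` norm_sols M" by (auto simp: z norm_sols_def)
  qed (auto simp: norm_sols_def eis_norm_mult M, auto simp: eis_norm_def eis_mult_def)
  moreover have "inj (eis_mult (int p, 0))"
    using p by (intro inj_eis_mult) (auto simp: eis_norm_def)
  ultimately show ?thesis using p M by (simp add: card_image inj_on_subset)
next
  case False
  have "{z \<in> norm_sols (p * N). int p dvd fst z \<and> int p dvd snd z} = {}"
  proof (rule ccontr)
    assume "\<not> ?thesis"
    then obtain z where z: "eis_norm z = int (p * N)" "int p dvd fst z" "int p dvd snd z"
      by (auto simp: norm_sols_def)
    then obtain x y where "fst z = int p * x" "snd z = int p * y" by (auto elim!: dvdE)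
    hence "int p * int N = int p * (int p * eis_norm (x, y))"
      using z by (simp add: eis_norm_def algebra_simps)
    hence "int N = int p * eis_norm (x, y)" using p by simp
    hence "int p dvd int N" by simp
    thus False using False by simp
  qed
  thus ?thesis using False by (metis card.empty)
qed

text \<open>From (x - y)(x^2 + xy + y^2) = x^3 - y^3 follows that x and y have equal cubes modulo p.
  If p does not divide y, it does not divide x either; since p - 1 is 1 modulo 3, Fermat then gives
  x = y modulo p, so the norm is 3y^2 modulo p, a contradiction.\<close>

lemma inert_prime:
  fixes x y :: int
  assumes p: "prime p" "p mod 3 = 2" and d: "int p dvd eis_norm (x, y)"
  shows "int p dvd x \<and> int p dvd y"
proof -
  have pp: "prime (int p)" using p by simp
  have x_if: "int p dvd x" if "int p dvd y"
  proof -
    have "int p dvd eis_norm (x, y) - (x + y) * y" using d that by (intro dvd_diff dvd_mult)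
    hence "int p dvd x * x" by (simp add: eis_norm_def algebra_simps)
    thus ?thesis using pp prime_dvd_mult_iff by blast
  qed
  have y_if: "int p dvd y" if "int p dvd x"
  proof -
    have "int p dvd eis_norm (x, y) - (x + y) * x" using d that by (intro dvd_diff dvd_mult)
    hence "int p dvd y * y" by (simp add: eis_norm_def algebra_simps)
    thus ?thesis using pp prime_dvd_mult_iff by blast
  qed
  have "int p dvd y"
  proof (rule ccontr)
    assume ny: "\<not> int p dvd y"
    hence nx: "\<not> int p dvd x" using y_if by blast
    have fermat: "[z ^ (p - 1) = 1] (mod int p)" if "\<not> int p dvd z" for z
    proof -
      have "coprime z (int p)" using that pp by (metis coprime_commute prime_imp_coprime)
      moreover have "residues (int p)" using prime_gt_1_nat[OF p(1)] by (simp add: residues_def)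
      ultimately have "[z ^ totient (nat (int p)) = 1] (mod int p)"
        using residues.euler_theorem[of "int p" z] by simp
      thus ?thesis using p by (simp add: totient_prime)
    qed
    obtain m where m: "p - 1 = 3 * m + 1"
    proof -
      have "p - 1 = 3 * (p div 3) + 1" using p by presburger
      thus ?thesis using that by blast
    qed
    have "int p dvd (x - y) * eis_norm (x, y)" using d by simp
    hence cube: "[x ^ 3 = y ^ 3] (mod int p)"
      by (simp add: cong_iff_dvd_diff eis_norm_def algebra_simps power3_eq_cube)
    have "[x ^ (3 * m) * x = y ^ (3 * m) * y] (mod int p)"
      using cong_trans[OF fermat[OF nx] cong_sym[OF fermat[OF ny]]] 
      unfolding m by (simp add: mult.commute)
    moreover have "[x ^ (3 * m) = y ^ (3 * m)] (mod int p)"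
      using cong_pow[OF cube, of m] by (simp add: power_mult)
    ultimately have "[x ^ (3 * m) * x = x ^ (3 * m) * y] (mod int p)"
      by (meson cong_scalar_right cong_sym cong_trans)
    hence "int p dvd x ^ (3 * m) * (x - y)"
      by (simp add: cong_iff_dvd_diff algebra_simps)
    hence xy: "int p dvd x - y" using nx pp prime_dvd_mult_iff prime_dvd_power by blast
    have "int p dvd eis_norm (x, y) - (x + 2 * y) * (x - y)"
      by (rule dvd_diff[OF d dvd_mult[OF xy]])
    hence "int p dvd 3 * (y * y)" by (simp add: eis_norm_def algebra_simps)
    hence "int p dvd 3" using ny pp by (simp add: prime_dvd_mult_iff)
    hence "p dvd 3" by (metis int_dvd_int_iff of_nat_numeral)
    hence "p = 3" using p by (simp add: primes_dvd_imp_eq)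
    thus False using p by simp
  qed
  thus ?thesis using x_if by blast
qed

text \<open>For a primitive root g, the power t = g^((p-1)/3) is a root of t^3 - 1 modulo p but not
  of t - 1.\<close>

lemma root_of_unity_3:
  assumes p: "prime p" "p mod 3 = 1"
  obtains t :: int where "int p dvd t * t + t + 1"
proof -
  have p1: "p > 1" using p prime_gt_1_nat by blast
  obtain g where "residue_primroot p g"
    using prime_primitive_root_exists[of p] p p1 by blast
  hence g: "ord p g = p - 1" using p by (simp add: residue_primroot_def totient_prime)
  define m where "m = p div 3"
  have m: "p - 1 = 3 * m" "m > 0" unfolding m_def using p p1 by presburger+
  define t where "t = int (g ^ m)"
  have "[g ^ (3 * m) = 1] (mod p)" using ord_divides[of g "3 * m" p] g m by simp
  hence "[(g ^ m) ^ 3 = 1] (mod p)" by (simp add: power_mult mult.commute)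
  hence "[t ^ 3 = 1] (mod int p)" unfolding t_def by (metis cong_int_iff of_nat_1 of_nat_power)
  hence "int p dvd t ^ 3 - 1" by (simp add: cong_iff_dvd_diff)
  also have "t ^ 3 - 1 = (t - 1) * (t * t + t + 1)" by (simp add: algebra_simps power3_eq_cube)
  finally have "int p dvd t - 1 \<or> int p dvd t * t + t + 1"
    using p prime_dvd_mult_iff[of "int p"] by simp
  moreover have "\<not> int p dvd t - 1"
  proof
    assume "int p dvd t - 1"
    hence "[g ^ m = 1] (mod p)" unfolding t_def by (metis cong_iff_dvd_diff cong_int_iff of_nat_1)
    hence "p - 1 dvd m" using ord_divides[of g m p] g by simp
    thus False using m by (auto dest: dvd_imp_le)
  qed
  ultimately show ?thesis using that by blast
qed

text \<open>Thue's argument: the pigeonhole principle gives a small nonzero \<open>(x, y)\<close> with \<open>x \<equiv> ty\<close>.\<close>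
lemma split_prime:
  assumes p: "prime p" "p mod 3 = 1"
  obtains w where "eis_norm w = int p"
proof -
  obtain t where t: "int p dvd t * t + t + 1" using root_of_unity_3[OF p] .
  have p0: "p > 0" using p prime_gt_0_nat by blast
  define s where "s = floor_sqrt p"
  have s: "s * s \<le> p" "p < (s + 1) * (s + 1)"
    using floor_sqrt_power2_le[of p] Suc_floor_sqrt_power2_gt[of p] by (auto simp: s_def power2_eq_square)
  \<comment> \<open>A prime is not a square. The strict inequality makes each of the three terms of
    the norm smaller than p, so that the norm is below 3p.\<close>
  have "s * s \<noteq> p" using p(1) by (metis prime_product mult_1 not_prime_1)
  hence ss: "s * s < p" using s by simp
  define f where "f = (\<lambda>(u, v). (int u - t * int v) mod int p)"
  let ?D = "{..s} \<times> {..s}"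
  have "\<not> inj_on f ?D"
  proof
    assume "inj_on f ?D"
    moreover have "f ` ?D \<subseteq> {0..<int p}" using p0 by (auto simp: f_def)
    ultimately have "card ?D \<le> card {0..<int p}" by (intro card_inj_on_le) auto
    thus False using s by simp
  qed
  then obtain u v u' v' where uv: "u \<le> s" "v \<le> s" "u' \<le> s" "v' \<le> s" "(u, v) \<noteq> (u', v')"
    and eq: "f (u, v) = f (u', v')" by (auto simp: inj_on_def)
  define x y where "x = int u - int u'" and "y = int v - int v'"
  have "int p dvd (int u - t * int v) - (int u' - t * int v')"
    using eq by (simp add: f_def mod_eq_dvd_iff)
  hence d: "int p dvd x - t * y" by (simp add: x_def y_def algebra_simps)
  \<comment> \<open>Modulo p the form splits into linear factors with roots t and -t - 1 for
    x/y.\<close>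
  have "eis_norm (x, y) = (x - t * y) * (x + t * y + y) + y * y * (t * t + t + 1)"
    by (simp add: eis_norm_def algebra_simps)
  hence "int p dvd eis_norm (x, y)" using d t by (metis dvd_add dvd_mult dvd_mult2)
  then obtain k where k: "eis_norm (x, y) = int p * k" by blast
  have "(x, y) \<noteq> (0, 0)" using uv by (auto simp: x_def y_def)
  hence "eis_norm (x, y) > 0" using eis_norm_nonneg[of "(x, y)"] eis_norm_eq_0[of "(x, y)"] by linarith
  hence k0: "k > 0" using k p0 by (simp add: zero_less_mult_iff)
  have abs: "\<bar>x\<bar> \<le> int s" "\<bar>y\<bar> \<le> int s" using uv by (auto simp: x_def y_def)
  have prod: "\<bar>a\<bar> * \<bar>b\<bar> < int p" if "\<bar>a\<bar> \<le> int s" "\<bar>b\<bar> \<le> int s" for a b :: int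
  proof -
    have "\<bar>a\<bar> * \<bar>b\<bar> \<le> int s * int s" using that by (intro mult_mono) auto
    also have "\<dots> < int p" using ss by (metis of_nat_less_iff of_nat_mult)
    finally show ?thesis .
  qed
  have "eis_norm (x, y) \<le> \<bar>x\<bar> * \<bar>x\<bar> + \<bar>x\<bar> * \<bar>y\<bar> + \<bar>y\<bar> * \<bar>y\<bar>"
    unfolding eis_norm_def by (simp flip: abs_mult)
  also have "\<dots> < 3 * int p" using prod[OF abs(1) abs(1)] prod[OF abs] prod[OF abs(2) abs(2)] by linarith
  finally have "k < 3" using k p0 by simp
  hence "k = 1 \<or> k = 2" using k0 by auto
  \<comment> \<open>Norm 2p is impossible: 2 is inert, so both coordinates would be even and the
    norm divisible by 4, forcing p = 2.\<close>
  moreover have "k \<noteq> 2"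
  proof
    assume "k = 2"
    hence ev: "eis_norm (x, y) = 2 * int p" using k by simp
    hence "int 2 dvd eis_norm (x, y)" by simp
    hence "int 2 dvd x \<and> int 2 dvd y" by (intro inert_prime) auto
    then obtain a b where "x = 2 * a" "y = 2 * b" by (auto elim!: evenE)
    hence "int p = 2 * eis_norm (a, b)" using ev by (simp add: eis_norm_def algebra_simps)
    hence "even p" by (metis dvd_triv_left even_of_nat)
    hence "p = 2" using p primes_dvd_imp_eq two_is_prime_nat by blast
    thus False using p by simp
  qed
  ultimately show ?thesis using k that by force
qed

text \<open>
  For \<open>p = w w'\<close> the elements of norm \<open>pN\<close> are the multiples of \<open>w\<close> or of its conjugate \<open>w'\<close>,
  and the multiples of both are the multiples of \<open>p\<close>. This is the recursion that
  \<open>sum_divisors_prime_mult\<close> gives for \<open>chi3\<close>.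
\<close>
lemma card_norm_sols_prime_mult:
  assumes p: "prime p" "p \<noteq> 3"
  shows "int (card (norm_sols (p * N))) = (1 + chi3 p) * int (card (norm_sols N))
          - chi3 p * int (if p dvd N then card (norm_sols (N div p)) else 0)"
proof -
  have p0: "p > 0" using p prime_gt_0_nat by blast
  have pp: "prime (int p)" using p by simp
  let ?B = "{z \<in> norm_sols (p * N). int p dvd fst z \<and> int p dvd snd z}"
  have p3: "prime (3::nat)" by simp
  have "\<not> 3 dvd p" using p primes_dvd_imp_eq[OF p3 p(1)] by blast
  hence "p mod 3 = 1 \<or> p mod 3 = 2" by presburger
  thus ?thesis
  proof
    assume p2: "p mod 3 = 2"
    have "norm_sols (p * N) = ?B"
    proof -
      have "int p dvd fst z \<and> int p dvd snd z" if "z \<in> norm_sols (p * N)" for z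
        using that inert_prime[OF p(1) p2, of "fst z" "snd z"] by (simp add: norm_sols_def)
      thus ?thesis by blast
    qed
    hence "card (norm_sols (p * N)) = (if p dvd N then card (norm_sols (N div p)) else 0)"
      using card_norm_sols_scaled[OF p0, of N] by metis
    thus ?thesis using p2 by (simp add: chi3_def)
  next
    assume p1: "p mod 3 = 1"
    obtain w where w: "eis_norm w = int p" using split_prime[OF p(1) p1] .
    have w': "eis_norm (eis_cnj w) = int p" by (simp add: w eis_norm_cnj)
    define L where "L w = eis_mult w ` norm_sols N" for w
    have cardL: "card (L v) = card (norm_sols N)" "finite (L v)" if "eis_norm v = int p" for v
    proof -
      have "inj_on (eis_mult v) (norm_sols N)"
        by (rule inj_on_subset[OF inj_eis_mult]) (use that p0 in simp_all)
      thus "card (L v) = card (norm_sols N)" unfolding L_def by (rule card_image)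
      show "finite (L v)" unfolding L_def using finite_norm_sols by (rule finite_imageI)
    qed
    have Lsub: "L v \<subseteq> norm_sols (p * N)" if "eis_norm v = int p" for v
      unfolding L_def norm_sols_def using that by (simp add: image_subset_iff eis_norm_mult)
    \<comment> \<open>Being a multiple of v amounts to p dividing the product of z with the
      conjugate of v. Testing the second coordinate is enough: that product has norm p^2 N, so p
      then divides the square of the first coordinate.\<close>
    have factor: "z \<in> L v"
      if v: "eis_norm v = int p" and z: "z \<in> norm_sols (p * N)" and d: "int p dvd snd (eis_mult (eis_cnj v) z)" for v z
    proof -
      define q where "q = eis_mult (eis_cnj v) z"
      have n: "eis_norm q = int p * int p * int N"
        using v z by (simp add: q_def eis_norm_mult eis_norm_cnj norm_sols_def)
      have "int p dvd eis_norm q - (fst q + snd q) * snd q"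
        using n d by (intro dvd_diff dvd_mult) (auto simp: q_def)
      hence "int p dvd fst q * fst q" by (simp add: eis_norm_def algebra_simps)
      hence "int p dvd fst q" using pp prime_dvd_mult_iff by blast
      then obtain a b where q: "q = (int p * a, int p * b)" using d
        by (cases q) (auto simp: q_def[symmetric] elim!: dvdE)
      have "eis_mult v q = eis_mult (int p, 0) z"
        using eis_mult_cnj[of "eis_cnj v" z] by (simp add: q_def eis_norm_cnj v)
      moreover have "eis_mult v q = eis_mult (int p, 0) (eis_mult v (a, b))"
        by (simp add: q eis_mult_def algebra_simps)
      moreover have "inj (eis_mult (int p, 0))"
        using p0 by (intro inj_eis_mult) (auto simp: eis_norm_def)
      ultimately have "z = eis_mult v (a, b)" by (metis injD)
      moreover have "int p * int p * eis_norm (a, b) = int p * int p * int N"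
        using n by (simp add: q eis_norm_def algebra_simps)
      hence "eis_norm (a, b) = int N" using p0 by simp
      ultimately show ?thesis by (auto simp: L_def norm_sols_def)
    qed
    have snd_L: "int p dvd snd (eis_mult (eis_cnj v) z)" if v: "eis_norm v = int p" and z: "z \<in> L v" for v z
    proof -
      obtain u where "z = eis_mult v u" using z by (auto simp: L_def)
      thus ?thesis by (simp add: eis_mult_cnj v) (simp add: eis_mult_def)
    qed
    obtain c d where cd: "w = (c, d)" by fastforce
    have nw: "c * c + c * d + d * d = int p" using w by (simp add: cd eis_norm_def)
    have un: "norm_sols (p * N) = L w \<union> L (eis_cnj w)"
    proof (intro equalityI subsetI)
      fix z assume z: "z \<in> norm_sols (p * N)"
      obtain x y where xy: "z = (x, y)" by fastforce
      have nz: "x * x + x * y + y * y = int p * int N" using z by (simp add: xy norm_sols_def eis_norm_def)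
      \<comment> \<open>The product of the two test coordinates is a combination of the norms of w
        and z, both multiples of p. Hence p divides one of them.\<close>
      have "snd (eis_mult (eis_cnj w) z) * snd (eis_mult w z)
          = y * y * (c * c + c * d + d * d) - d * d * (x * x + x * y + y * y)"
        by (simp add: xy cd eis_mult_def eis_cnj_def algebra_simps)
      also have "\<dots> = int p * (y * y - d * d * int N)"
        unfolding nw nz by (simp add: algebra_simps)
      finally have "int p dvd snd (eis_mult (eis_cnj w) z) * snd (eis_mult (eis_cnj (eis_cnj w)) z)" by simp
      thus "z \<in> L w \<union> L (eis_cnj w)"
        using factor[OF w z] factor[OF w' z] pp prime_dvd_mult_iff by blast
    qed (use Lsub[OF w] Lsub[OF w'] in auto)
    have "L w \<inter> L (eis_cnj w) = ?B"
    proof (intro equalityI subsetI)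
      fix z assume z: "z \<in> L w \<inter> L (eis_cnj w)"
      obtain x y where xy: "z = (x, y)" by fastforce
      have "int p dvd snd (eis_mult (eis_cnj w) z)" "int p dvd snd (eis_mult w z)"
        using snd_L[OF w, of z] snd_L[OF w', of z] z by auto
      hence d1: "int p dvd c * y - d * x" and d2: "int p dvd c * y + d * x + d * y"
        by (simp_all add: xy cd eis_mult_def eis_cnj_def algebra_simps)
      have nd: "\<not> int p dvd d"
      proof
        assume a: "int p dvd d"
        hence "int p dvd int p - (c + d) * d" by (intro dvd_diff dvd_mult) auto
        hence "int p dvd c * c" by (simp add: nw[symmetric] algebra_simps)
        hence b: "int p dvd c" using pp prime_dvd_mult_iff by blast
        have "int p * int p dvd c * c + c * d + d * d" using a b by (intro dvd_add mult_dvd_mono)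
        hence "int p * int p dvd int p * 1" unfolding nw by simp
        hence "int p dvd 1" using p0 by (metis dvd_mult_cancel_left of_nat_0_less_iff less_irrefl)
        thus False using pp not_prime_unit by blast
      qed
      \<comment> \<open>As (2c + d)^2 + 3d^2 = 4p, this says that p is unramified. It is needed
        because the two test coordinates add up to (2c + d)y.\<close>
      have n2: "\<not> int p dvd 2 * c + d"
      proof
        assume a: "int p dvd 2 * c + d"
        have "3 * (d * d) = 4 * int p - (2 * c + d) * (2 * c + d)"
          by (simp add: nw[symmetric] algebra_simps)
        hence "int p dvd 3 * (d * d)" using a by simp
        hence "int p dvd 3" using nd pp by (simp add: prime_dvd_mult_iff)
        hence "p dvd 3" by (metis int_dvd_int_iff of_nat_numeral)
        thus False using p by (simp add: primes_dvd_imp_eq)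
      qed
      have "int p dvd (2 * c + d) * y" using dvd_add[OF d1 d2] by (simp add: algebra_simps)
      hence y: "int p dvd y" using n2 pp prime_dvd_mult_iff by blast
      have "int p dvd c * y - (c * y - d * x)" by (rule dvd_diff[OF dvd_mult[OF y] d1])
      hence "int p dvd d * x" by simp
      hence "int p dvd x" using nd pp prime_dvd_mult_iff by blast
      thus "z \<in> ?B" using y z Lsub[OF w] by (auto simp: xy)
    next
      fix z assume z: "z \<in> ?B"
      have "int p dvd snd (eis_mult v z)" for v
        using z by (auto simp: eis_mult_def intro!: dvd_add)
      thus "z \<in> L w \<inter> L (eis_cnj w)" using factor[OF w] factor[OF w'] z by blast
    qed
    hence "card (norm_sols (p * N)) + card ?B = 2 * card (norm_sols N)"
      using card_Un_Int[of "L w" "L (eis_cnj w)"] cardL[OF w] cardL[OF w'] by (simp add: un)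
    hence "int (card (norm_sols (p * N))) = 2 * int (card (norm_sols N)) - int (card ?B)" by linarith
    thus ?thesis using p1 unfolding card_norm_sols_scaled[OF p0] by (simp add: chi3_def)
  qed
qed

section \<open>The number of elements of given norm\<close>

lemma card_norm_sols_1: "card (norm_sols 1) = 6"
proof -
  have "norm_sols 1 = {(1,0),(-1,0),(0,1),(0,-1),(1,-1),(-1,1)}"
  proof (intro equalityI subsetI)
    fix z assume "z \<in> norm_sols 1"
    hence n: "eis_norm z = 1" by (simp add: norm_sols_def)
    have "\<bar>t\<bar> \<le> 1" if "3 * t\<^sup>2 \<le> 4" for t :: int
    proof (rule ccontr)
      assume "\<not> \<bar>t\<bar> \<le> 1"
      hence "2 ^ 2 \<le> \<bar>t\<bar> ^ 2" by (intro power_mono) auto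
      thus False using that by simp
    qed
    moreover have "3 * (snd z)\<^sup>2 \<le> 4" "3 * (fst z)\<^sup>2 \<le> 4"
      using four_eis_norm[of z] zero_le_power2[of "2 * fst z + snd z"]
       zero_le_power2[of "2 * snd z + fst z"] n by linarith+
    ultimately have "\<bar>fst z\<bar> \<le> 1" "\<bar>snd z\<bar> \<le> 1" by blast+
    hence "fst z \<in> {-1,0,1}" "snd z \<in> {-1,0,1}" by auto
    thus "z \<in> {(1,0),(-1,0),(0,1),(0,-1),(1,-1),(-1,1)}"
      using n by (cases z) (auto simp: eis_norm_def)
  qed (auto simp: norm_sols_def eis_norm_def)
  thus ?thesis by simp
qed

text \<open>Both sides satisfy the same recursion when a prime is split off, and the six units start
  it. The prime 3 is excluded since the recursion is available only for p other than 3.\<close>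

lemma card_norm_sols:
  assumes "\<not> 3 dvd N"
  shows "int (card (norm_sols N)) = 6 * (\<Sum>d | d dvd N. chi3 d)"
  using assms
proof (induction N rule: less_induct)
  case (less N)
  show ?case
  proof (cases "N = 1")
    case True
    thus ?thesis using card_norm_sols_1 by (simp add: chi3_def)
  next
    case False
    then obtain p where p: "prime p" "p dvd N" using prime_factor_nat by blast
    then obtain M where M: "N = p * M" by blast
    have p3: "p \<noteq> 3" and M3: "\<not> 3 dvd M" using less.prems M by auto
    have M0: "M > 0" using M3 by (cases M) auto
    have lt: "M < N" "M div p < N" using M M0 prime_gt_1_nat[OF p(1)] by (auto intro: le_less_trans[OF div_le_dividend])
    have "\<not> 3 dvd M div p" if "p dvd M" using that M3 by (metis dvd_div_mult_self dvd_mult2)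
    thus ?thesis
      unfolding M card_norm_sols_prime_mult[OF p(1) p3]
        sum_divisors_prime_mult[of p M chi3, OF p(1) M0 chi3_mult]
      using less.IH[OF lt(1) M3] less.IH[OF lt(2)] by (simp add: algebra_simps)
  qed
qed

section \<open>Coordinates of 3-cores\<close>

text \<open>
  The first-column hook lengths. Removing a rim hook of length \<open>t\<close> lowers one of them by \<open>t\<close>,
  and they are positive because a partition has no zero parts.
\<close>
primrec beta_set :: "nat list \<Rightarrow> nat set" where
  "beta_set [] = {}"
| "beta_set (x # xs) = insert (x + length xs) (beta_set xs)"

lemma is_partition_Cons:
  "is_partition (x # xs) \<longleftrightarrow> is_partition xs \<and> 0 < x \<and> (\<forall>y\<in>set xs. y \<le> x)"
  by (auto simp: is_partition_def)

lemma is_partition_Nil [simp]: "is_partition []"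
  by (simp add: is_partition_def)

lemma finite_beta_set [simp]: "finite (beta_set xs)"
  by (induction xs) auto

lemma beta_set_bound:
  "\<lbrakk>v \<in> beta_set xs; \<forall>y\<in>set xs. y \<le> x\<rbrakk> \<Longrightarrow> v < x + length xs"
proof (induction xs arbitrary: x)
  case (Cons z zs)
  thus ?case by fastforce
qed auto

lemma beta_set_pos: "is_partition xs \<Longrightarrow> 0 \<notin> beta_set xs"
  by (induction xs) (auto simp: is_partition_Cons)

lemma card_beta_set: "is_partition xs \<Longrightarrow> card (beta_set xs) = length xs"
  by (induction xs) (auto simp: is_partition_Cons card_insert_if dest: beta_set_bound)

text \<open>From the last part upwards, the entries exceed the parts by 0, 1, ..., l - 1 for l
  parts. Doubling and adding l avoids division and subtraction.\<close>

lemma sum_beta_set: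
  "is_partition xs \<Longrightarrow> 2 * \<Sum>(beta_set xs) + length xs = 2 * sum_list xs + length xs * length xs"
proof (induction xs)
  case (Cons x xs)
  hence "x + length xs \<notin> beta_set xs" using beta_set_bound by (fastforce simp: is_partition_Cons)
  thus ?case using Cons by (simp add: is_partition_Cons)
qed auto

lemma beta_set_inject:
  "\<lbrakk>is_partition xs; is_partition ys; beta_set xs = beta_set ys\<rbrakk> \<Longrightarrow> xs = ys"
proof (induction xs arbitrary: ys)
  case Nil
  thus ?case by (cases ys) auto
next
  case (Cons x xs)
  have len: "length (x # xs) = length ys"
    using Cons.prems card_beta_set by metis
  then obtain y zs where ys: "ys = y # zs" by (cases ys) auto
  have x: "v < x + length xs" if "v \<in> beta_set xs" for v
    using beta_set_bound[OF that] Cons.prems by (auto simp: is_partition_Cons)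
  have y: "v < y + length zs" if "v \<in> beta_set zs" for v
    using beta_set_bound[OF that] Cons.prems by (auto simp: is_partition_Cons ys)
  have eq: "insert (x + length xs) (beta_set xs) = insert (y + length zs) (beta_set zs)"
    using Cons.prems by (simp add: ys)
  have "x + length xs = y + length zs"
    using eq x y by (metis insert_iff less_asym)
  moreover from this have "beta_set xs = beta_set zs"
    using eq x y by (metis insert_ident less_irrefl)
  ultimately show ?case using Cons len by (auto simp: ys is_partition_Cons)
qed

text \<open>The largest element becomes the first part after subtracting the number of the others.
  Strictly decreasing entries give weakly decreasing parts, and \<open>0 \<notin> X\<close> makes
  the smallest part positive.\<close>

lemma beta_set_surj:
  assumes "finite X" "0 \<notin> X"
  shows "\<exists>xs. is_partition xs \<and> beta_set xs = X"
  using assms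
proof (induction "card X" arbitrary: X)
  case 0
  thus ?case by (intro exI[of _ "[]"]) auto
next
  case (Suc n)
  hence ne: "X \<noteq> {}" by auto
  define m where "m = Max X"
  have m: "m \<in> X" "\<And>v. v \<in> X \<Longrightarrow> v \<le> m" using Suc.prems ne by (auto simp: m_def)
  have "card (X - {m}) = n" using Suc m by simp
  then obtain xs where xs: "is_partition xs" "beta_set xs = X - {m}"
    using Suc.hyps(1)[of "X - {m}"] Suc.prems by auto
  have lt: "v < m" if "v \<in> beta_set xs" for v using that xs m(2)[of v] by auto
  have "\<exists>x. m = x + length xs \<and> 0 < x \<and> (\<forall>y\<in>set xs. y \<le> x)"
  proof (cases xs)
    case Nil
    moreover have "0 < m" using m Suc.prems by (metis gr0I)
    ultimately show ?thesis by (intro exI[of _ m]) auto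
  next
    case (Cons z zs)
    hence "z + length zs < m" using lt by auto
    thus ?thesis using xs Cons by (intro exI[of _ "m - length xs"]) (auto simp: is_partition_Cons)
  qed
  then obtain x where "m = x + length xs" "0 < x" "\<forall>y\<in>set xs. y \<le> x" by blast
  thus ?case using xs m by (intro exI[of _ "x # xs"]) (auto simp: is_partition_Cons)
qed

section \<open>Hook lengths and gaps of the beta set\<close>

lemma conj_part_le_length: "conj_part xs j \<le> length xs"
  by (simp add: conj_part_def)

lemma conj_part_eq_0: "\<forall>y\<in>set xs. y \<le> j \<Longrightarrow> conj_part xs j = 0"
  by (auto simp: conj_part_def filter_empty_conv)

lemma conj_part_Cons: "conj_part (x # xs) j = (if j < x then 1 else 0) + conj_part xs j"
  by (simp add: conj_part_def)

text \<open>Along the boundary path of the Young diagram the entries label the vertical steps, and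
  the gaps label the horizontal ones, one for each column j. Columns of length 0 are included and
  give all gaps beyond the largest entry.\<close>

lemma notin_beta_set_iff:
  "is_partition xs \<Longrightarrow> v \<notin> beta_set xs \<longleftrightarrow> (\<exists>j. v + conj_part xs j = j + length xs)"
proof (induction xs)
  case Nil
  show ?case by (simp add: conj_part_def)
next
  case (Cons x xs)
  have xs: "is_partition xs" "\<forall>y\<in>set xs. y \<le> x" using Cons.prems by (auto simp: is_partition_Cons)
  have z: "conj_part xs j = 0" if "x \<le> j" for j
    using that xs by (intro conj_part_eq_0) auto
  have "(\<exists>j. v + conj_part (x # xs) j = j + length (x # xs)) \<longleftrightarrow>
     (\<exists>j<x. v + conj_part xs j = j + length xs) \<or> (\<exists>j\<ge>x. v = j + length xs + 1)"
    using z by (force simp: conj_part_Cons not_less)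
  also have "(\<exists>j\<ge>x. v = j + length xs + 1) \<longleftrightarrow> (\<exists>j\<ge>x. v = j + length xs) \<and> v \<noteq> x + length xs"
    by presburger
  also have "(\<exists>j<x. v + conj_part xs j = j + length xs) \<longleftrightarrow>
      (\<exists>j<x. v + conj_part xs j = j + length xs) \<and> v \<noteq> x + length xs"
    by auto
  also have "(\<exists>j<x. v + conj_part xs j = j + length xs) \<and> v \<noteq> x + length xs \<or>
      (\<exists>j\<ge>x. v = j + length xs) \<and> v \<noteq> x + length xs \<longleftrightarrow>
      (\<exists>j. v + conj_part xs j = j + length xs) \<and> v \<noteq> x + length xs"
    using z by (metis add.right_neutral not_less)
  finally show ?case using Cons.IH xs by auto
qed

text \<open>Adding a row on top shifts the lower rows but leaves their arms and legs alone, so only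
  the hooks of the new row are tested.\<close>

lemma is_t_core_Cons:
  assumes "is_partition (x # xs)"
  shows "is_t_core t (x # xs) \<longleftrightarrow>
    is_t_core t xs \<and> (\<forall>j<x. \<not> t dvd (x + conj_part xs j - j))"
proof -
  have "(\<forall>i<length (x # xs). \<forall>j<(x # xs) ! i. \<not> t dvd hook_length (x # xs) i j) \<longleftrightarrow>
     (\<forall>j<x. \<not> t dvd hook_length (x # xs) 0 j) \<and>
     (\<forall>i<length xs. \<forall>j<xs ! i. \<not> t dvd hook_length (x # xs) (Suc i) j)"
    by (auto simp: less_Suc_eq_0_disj)
  moreover have "hook_length (x # xs) 0 j = x + conj_part xs j - j" if "j < x" for j
    using that by (simp add: hook_length_def conj_part_Cons)
  moreover have "hook_length (x # xs) (Suc i) j = hook_length xs i j" if "i < length xs" "j < xs ! i" for i j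
  proof -
    have "xs ! i \<le> x" using assms that by (auto simp: is_partition_Cons)
    thus ?thesis using that by (simp add: hook_length_def conj_part_Cons)
  qed
  ultimately show ?thesis unfolding is_t_core_def by auto
qed

text \<open>The hook lengths of the first row are the differences between the largest entry and the
  gaps below it. So being a core means that no gap lies below an entry at a distance divisible by
  t.\<close>

lemma is_t_core_iff_beta_set:
  "is_partition xs \<Longrightarrow> is_t_core t xs \<longleftrightarrow>
     (\<forall>v\<in>beta_set xs. \<forall>w<v. t dvd v - w \<longrightarrow> w \<in> beta_set xs)"
proof (induction xs)
  case Nil
  show ?case by (simp add: is_t_core_def)
next
  case (Cons x xs)
  let ?m = "x + length xs"
  have xs: "is_partition xs" "\<forall>y\<in>set xs. y \<le> x" using Cons.prems by (auto simp: is_partition_Cons)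
  have lt: "v < ?m" if "v \<in> beta_set xs" for v using beta_set_bound[OF that xs(2)] .
  have "(\<forall>j<x. \<not> t dvd (x + conj_part xs j - j)) \<longleftrightarrow>
     (\<forall>w<?m. t dvd ?m - w \<longrightarrow> w \<in> beta_set xs)"
  proof (intro iffI allI impI)
    fix w assume *: "\<forall>j<x. \<not> t dvd (x + conj_part xs j - j)" "w < ?m" "t dvd ?m - w"
    show "w \<in> beta_set xs"
    proof (rule ccontr)
      assume "w \<notin> beta_set xs"
      then obtain j where j: "w + conj_part xs j = j + length xs"
        using notin_beta_set_iff[OF xs(1)] by blast
      have "j < x"
      proof (rule ccontr)
        assume "\<not> j < x"
        hence "conj_part xs j = 0" using xs by (intro conj_part_eq_0) auto
        thus False using j \<open>\<not> j < x\<close> *(2) by simp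
      qed
      moreover have "x + conj_part xs j - j = ?m - w" using j by linarith
      ultimately show False using * by metis
    qed
  next
    fix j assume *: "\<forall>w<?m. t dvd ?m - w \<longrightarrow> w \<in> beta_set xs" "j < x"
    define w where "w = j + length xs - conj_part xs j"
    have w: "w + conj_part xs j = j + length xs"
      using conj_part_le_length[of xs j] by (simp add: w_def)
    hence "w \<notin> beta_set xs" using notin_beta_set_iff[OF xs(1)] by blast
    moreover have "w < ?m" "x + conj_part xs j - j = ?m - w" using w *(2) by linarith+
    ultimately show "\<not> t dvd x + conj_part xs j - j" using *(1) by metis
  qed
  moreover have "w \<in> beta_set (x # xs) \<longleftrightarrow> w \<in> beta_set xs" if "v \<in> beta_set (x # xs)" "w < v" for v w
    using that lt[of v] by auto
  ultimately show ?case
    unfolding is_t_core_Cons[OF Cons.prems] Cons.IH[OF xs(1)] by auto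
qed

text \<open>The abacus with three runners, all beads pushed down. The runner of the multiples of 3
  stays empty, since a bead there would slide to 0.\<close>

definition runners :: "nat \<Rightarrow> nat \<Rightarrow> nat set" where
  "runners a b = (\<lambda>i. 3 * i + 1) ` {..<a} \<union> (\<lambda>i. 3 * i + 2) ` {..<b}"

lemma finite_down_closed:
  fixes A :: "nat set"
  assumes "finite A" "\<And>i j. i \<in> A \<Longrightarrow> j < i \<Longrightarrow> j \<in> A"
  shows "\<exists>n. A = {..<n}"
proof (cases "A = {}")
  case True
  thus ?thesis by (intro exI[of _ 0]) auto
next
  case False
  have "A = {..<Suc (Max A)}"
  proof (intro equalityI subsetI)
    fix i assume "i \<in> {..<Suc (Max A)}"
    hence "i = Max A \<or> i < Max A" by auto
    thus "i \<in> A" using assms(2)[OF Max_in[OF assms(1) False], of i] Max_in[OF assms(1) False] by auto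
  qed (use assms in \<open>auto simp: less_Suc_eq_le\<close>)
  thus ?thesis by blast
qed

lemma runners_mem:
  "3 * i \<notin> runners a b" "3 * i + 1 \<in> runners a b \<longleftrightarrow> i < a" "3 * i + 2 \<in> runners a b \<longleftrightarrow> i < b"
  unfolding runners_def by (auto; presburger)+

text \<open>Closure under descending in steps of 3 makes each residue class an initial segment, and
  the class of 0 is empty because 0 is missing.\<close>

lemma closed_3_iff_runners:
  assumes "finite X" "0 \<notin> X"
  shows "(\<forall>v\<in>X. \<forall>w<v. 3 dvd v - w \<longrightarrow> w \<in> X) \<longleftrightarrow> (\<exists>a b. X = runners a b)"
proof
  assume *: "\<forall>v\<in>X. \<forall>w<v. 3 dvd v - w \<longrightarrow> w \<in> X"
  have fin: "finite {i. 3 * i + r \<in> X}" for r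
    using finite_vimageI[OF assms(1), of "\<lambda>i. 3 * i + r"] by (simp add: vimage_def inj_def)
  have cl: "3 * j + r \<in> X" if "3 * i + r \<in> X" "j < i" for i j r
  proof -
    have "(3 * i + r) - (3 * j + r) = 3 * (i - j)" using that by simp
    thus ?thesis using * that by (metis add_less_cancel_right dvd_triv_left mult_less_cancel1 zero_less_numeral)
  qed
  have "\<exists>n. {i. 3 * i + r \<in> X} = {..<n}" for r
    by (rule finite_down_closed[OF fin]) (use cl in auto)
  then obtain a b where a: "{i. 3 * i + 1 \<in> X} = {..<a}" and b: "{i. 3 * i + 2 \<in> X} = {..<b}" by metis
  have z: "3 * i \<notin> X" for i
    using cl[of i 0 0] assms(2) by (cases "i = 0") auto
  have "v \<in> X \<longleftrightarrow> v \<in> runners a b" for v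
    using a b z by (cases v rule: nat_mod_3_cases) (simp_all add: runners_mem del: add_2_eq_Suc' One_nat_def, auto)
  thus "\<exists>a b. X = runners a b" by blast
next
  assume "\<exists>a b. X = runners a b"
  then obtain a b where X: "X = runners a b" by blast
  show "\<forall>v\<in>X. \<forall>w<v. 3 dvd v - w \<longrightarrow> w \<in> X"
  proof (intro ballI allI impI)
    fix v w assume v: "v \<in> X" "w < v" "3 dvd v - w"
    then obtain k where k: "v = w + 3 * k" by (metis dvdE le_add_diff_inverse less_imp_le)
    show "w \<in> X"
    proof (cases w rule: nat_mod_3_cases)
      case (1 i)
      hence "v = 3 * (i + k)" using k by simp
      thus ?thesis using v X runners_mem(1) by metis
    next
      case (2 i)
      hence "v = 3 * (i + k) + 1" using k by simp
      hence "i + k < a" using v X runners_mem(2) by metis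
      thus ?thesis using 2 X runners_mem(2)[of i] by simp
    next
      case (3 i)
      hence "v = 3 * (i + k) + 2" using k by simp
      hence "i + k < b" using v X runners_mem(3) by metis
      thus ?thesis using 3 X runners_mem(3)[of i] by simp
    qed
  qed
qed

lemma runners_inject: "runners a b = runners c d \<longleftrightarrow> a = c \<and> b = d"
  by (metis runners_mem(2,3) less_irrefl linorder_neqE_nat)

lemma finite_runners: "finite (runners a b)" and zero_notin_runners: "0 \<notin> runners a b"
  by (auto simp: runners_def)

lemma runners_disjoint: "(\<lambda>i::nat. 3 * i + 1) ` A \<inter> (\<lambda>i. 3 * i + 2) ` B = {}"
proof -
  have "3 * i + 1 \<noteq> 3 * j + 2" for i j :: nat by presburger
  thus ?thesis by blast
qed

lemma card_runners: "card (runners a b) = a + b"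
proof -
  have "card ((\<lambda>i::nat. 3 * i + r) ` {..<n}) = n" for r n
    by (subst card_image) (auto simp: inj_on_def)
  thus ?thesis
    unfolding runners_def by (subst card_Un_disjoint) (simp_all only: runners_disjoint finite_imageI finite_lessThan)
qed

lemma sum_runners: "2 * \<Sum>(runners a b) + a = 3 * a * a + 3 * b * b + b"
proof -
  have "\<Sum>(runners a b) = (\<Sum>i<a. 3 * i + 1) + (\<Sum>i<b. 3 * i + 2)"
    unfolding runners_def
    by (subst sum.union_disjoint) (simp_all only: runners_disjoint finite_imageI finite_lessThan, auto simp: sum.reindex inj_on_def)
  moreover have "2 * (\<Sum>i<a. 3 * i + 1) + a = 3 * a * a" by (induction a) (auto simp: algebra_simps)
  moreover have "2 * (\<Sum>i<b. 3 * i + 2) = 3 * b * b + b" by (induction b) (auto simp: algebra_simps)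
  ultimately show ?thesis by linarith
qed

section \<open>Parametrisation of the 3-cores by pairs of natural numbers\<close>

definition core_of :: "nat \<times> nat \<Rightarrow> nat list" where
  "core_of ab = (THE xs. is_partition xs \<and> beta_set xs = runners (fst ab) (snd ab))"

lemma core_of: "is_partition (core_of (a, b))" "beta_set (core_of (a, b)) = runners a b"
proof -
  have "\<exists>!xs. is_partition xs \<and> beta_set xs = runners a b"
    using beta_set_surj[OF finite_runners zero_notin_runners] beta_set_inject by metis
  from theI'[OF this] show "is_partition (core_of (a, b))" "beta_set (core_of (a, b)) = runners a b"
    by (auto simp: core_of_def)
qed

text \<open>The size is the sum of the bead positions minus the triangular number (a + b)(a + b -
  1)/2, as there are a + b parts. The term ab is moved to the left to stay within the
  naturals.\<close>

lemma sum_list_core_of: "sum_list (core_of (a, b)) + a * b = a * a + b * b + b"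
proof -
  have "length (core_of (a, b)) = a + b"
    using card_beta_set core_of card_runners by metis
  hence "2 * \<Sum>(runners a b) + (a + b) = 2 * sum_list (core_of (a, b)) + (a + b) * (a + b)"
    using sum_beta_set[OF core_of(1)[of a b]] by (simp only: core_of(2))
  hence "2 * (sum_list (core_of (a, b)) + a * b) = 2 * (a * a + b * b + b)"
    using sum_runners[of a b] by (simp add: algebra_simps)
  thus ?thesis by simp
qed

lemma bij_betw_core_of: "bij_betw core_of UNIV {xs. is_partition xs \<and> is_t_core 3 xs}"
proof (rule bij_betwI')
  fix p q :: "nat \<times> nat"
  show "core_of p = core_of q \<longleftrightarrow> p = q"
    by (metis core_of(2) runners_inject surj_pair)
next
  fix p :: "nat \<times> nat"
  obtain a b where p: "p = (a, b)" by fastforce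
  have "is_t_core 3 (core_of p)"
    unfolding p is_t_core_iff_beta_set[OF core_of(1)] core_of(2)
    using closed_3_iff_runners[OF finite_runners zero_notin_runners] by blast
  thus "core_of p \<in> {xs. is_partition xs \<and> is_t_core 3 xs}" using core_of(1) p by simp
next
  fix xs assume "xs \<in> {xs. is_partition xs \<and> is_t_core 3 xs}"
  hence xs: "is_partition xs" "is_t_core 3 xs" by auto
  then obtain a b where "beta_set xs = runners a b"
    using is_t_core_iff_beta_set[OF xs(1)] closed_3_iff_runners[OF finite_beta_set beta_set_pos[OF xs(1)]] by auto
  hence "xs = core_of (a, b)" using beta_set_inject[OF xs(1) core_of(1)] core_of(2) by simp
  thus "\<exists>p\<in>UNIV. xs = core_of p" by blast
qed

definition core_coords :: "nat \<Rightarrow> (nat \<times> nat) set" where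
  "core_coords n = {(a, b). a * a + b * b + b = n + a * b}"

lemma bij_betw_core_coords:
  "bij_betw core_of (core_coords n) {xs. is_partition xs \<and> is_t_core 3 xs \<and> sum_list xs = n}"
proof -
  have "bij_betw core_of {p \<in> UNIV. p \<in> core_coords n}
      {xs \<in> {xs. is_partition xs \<and> is_t_core 3 xs}. sum_list xs = n}"
  proof (rule bij_betw_Collect[OF bij_betw_core_of])
    fix p :: "nat \<times> nat"
    obtain a b where p: "p = (a, b)" by fastforce
    show "sum_list (core_of p) = n \<longleftrightarrow> p \<in> core_coords n"
      using sum_list_core_of[of a b] by (auto simp: p core_coords_def)
  qed
  thus ?thesis by (simp add: conj_assoc)
qed

lemma finite_core_coords: "finite (core_coords n)"
proof (rule finite_subset)
  have "a \<le> n + 1 \<and> b \<le> n" if "a * a + b * b + b = n + a * b" for a b :: nat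
  proof -
    have "int a * int a + int b * int b + int b = int n + int a * int b"
      using that by (metis of_nat_add of_nat_mult)
    \<comment> \<open>All three summands are nonnegative, so b is bounded; a is bounded through a =
      b + (a - b) and d <= d^2.\<close>
    hence e: "(int a - int b)\<^sup>2 + int a * int b + int b = int n"
      by (simp add: power2_eq_square algebra_simps)
    moreover have "int a * int b \<ge> 0" "(int a - int b)\<^sup>2 \<ge> 0" by auto
    ultimately have b: "int b \<le> int n" by linarith
    have "d \<le> d\<^sup>2" for d :: int
      by (cases "d \<le> 0") (simp_all add: order_trans[OF _ zero_le_power2] self_le_power)
    from this[of "int a - int b"] have "int a \<le> int n" using e \<open>int a * int b \<ge> 0\<close> by linarith
    thus ?thesis using b by linarith
  qed
  thus "core_coords n \<subseteq> {..n+1} \<times> {..n}" by (auto simp: core_coords_def)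
qed simp

lemma A3_convolution: "A3 n = (\<Sum>i\<le>n. card (core_coords i) * card (core_coords (n - i)))"
proof -
  define C where "C i = {xs. is_partition xs \<and> is_t_core 3 xs \<and> sum_list xs = i}" for i
  have card: "card (C i) = card (core_coords i)" "finite (C i)" for i
    using bij_betw_same_card[OF bij_betw_core_coords[of i]]
      bij_betw_finite[OF bij_betw_core_coords[of i]] finite_core_coords
    by (simp_all add: C_def)
  have "{(l1, l2). is_partition l1 \<and> is_partition l2 \<and> is_t_core 3 l1 \<and> is_t_core 3 l2 \<and>
          sum_list l1 + sum_list l2 = n} = (\<Union>i\<le>n. C i \<times> C (n - i))"
    by (auto simp: C_def)
  hence "A3 n = card (\<Union>i\<le>n. C i \<times> C (n - i))" by (simp add: A3_def)
  also have "\<dots> = (\<Sum>i\<le>n. card (C i \<times> C (n - i)))"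
    using card(2) by (intro card_UN_disjoint) (auto simp: C_def)
  finally show ?thesis by (simp add: card_cartesian_product card)
qed

section \<open>Pairs of 3-cores\<close>

text \<open>
  Half of the solutions satisfy \<open>x - y \<equiv> 1 (mod 3)\<close>; these are permuted by the rotation of order 3,
  for which the cone \<open>2x + y > 0, x + 2y > 0\<close> is a fundamental domain. Its points are the images
  of the coordinates of the cores.
\<close>
lemma card_core_coords: "card (norm_sols (3 * m + 1)) = 6 * card (core_coords m)"
proof -
  define S where "S r = {(x, y). (x, y) \<in> norm_sols (3 * m + 1) \<and> (x - y) mod 3 = r}" for r :: int
  define C where "C = {(x, y). (x, y) \<in> S 1 \<and> 0 < 2 * x + y \<and> 0 < x + 2 * y}"
  define C' where "C' = {(x, y). (x, y) \<in> S 1 \<and> x + 2 * y < 0 \<and> 0 < x - y}"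
  define C'' where "C'' = {(x, y). (x, y) \<in> S 1 \<and> 2 * x + y < 0 \<and> x - y < 0}"
  have fin: "finite (S r)" for r
    by (rule finite_subset[OF _ finite_norm_sols[of "3 * m + 1"]]) (auto simp: S_def)
  have sub: "C \<subseteq> S 1" "C' \<subseteq> S 1" "C'' \<subseteq> S 1" by (auto simp: C_def C'_def C''_def)
  \<comment> \<open>If x and y agree modulo 3, the norm is a multiple of 3.\<close>
  have S0: "S 0 = {}"
  proof (rule ccontr)
    assume "S 0 \<noteq> {}"
    then obtain x y where n: "eis_norm (x, y) = int (3 * m + 1)" and "(x - y) mod 3 = 0"
      by (auto simp: S_def norm_sols_def)
    then obtain k where "x = y + 3 * k" by (metis add.commute diff_add_cancel dvd_imp_mod_0 mod_0_imp_dvd dvdE)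
    hence "eis_norm (x, y) = 3 * (y * y + 3 * k * y + 3 * k * k)"
      by (simp add: eis_norm_def algebra_simps)
    thus False using n by presburger
  qed
  have "norm_sols (3 * m + 1) = S 0 \<union> S 1 \<union> S 2"
  proof -
    have "(x - y) mod 3 = 0 \<or> (x - y) mod 3 = 1 \<or> (x - y) mod 3 = 2" for x y :: int by presburger
    thus ?thesis by (auto simp: S_def)
  qed
  moreover have "S 1 \<inter> S 2 = {}" by (auto simp: S_def)
  moreover have "card (S 1) = card (S 2)"
  proof -
    have "eis_norm (- x, - y) = eis_norm (x, y)" "(- x - - y) mod 3 = 2 \<longleftrightarrow> (x - y) mod 3 = 1"
      "(- x - - y) mod 3 = 1 \<longleftrightarrow> (x - y) mod 3 = 2" for x y :: int
      by (simp add: eis_norm_def, presburger+)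
    hence neg: "(- x, - y) \<in> S 2 \<longleftrightarrow> (x, y) \<in> S 1" "(- x, - y) \<in> S 1 \<longleftrightarrow> (x, y) \<in> S 2" for x y
      by (simp_all only: S_def norm_sols_def mem_Collect_eq prod.case)
    show ?thesis
      by (rule bij_betw_same_card[of "\<lambda>(x, y). (- x, - y)"], rule bij_betw_byWitness[of _ "\<lambda>(x, y). (- x, - y)"])
         (auto simp: neg)
  qed
  ultimately have 1: "card (norm_sols (3 * m + 1)) = 2 * card (S 1)"
    by (simp add: S0 card_Un_disjoint fin)
  \<comment> \<open>These two maps are multiplication by the fourth and the second power of
    \<omega>, the rotations of order 3.\<close>
  have "eis_norm (y, - x - y) = eis_norm (x, y)" "(y - (- x - y)) mod 3 = (x - y) mod 3"
    "eis_norm (- x - y, x) = eis_norm (x, y)" "(- x - y - x) mod 3 = (x - y) mod 3" for x y :: int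
    by (simp add: eis_norm_def algebra_simps, presburger, simp add: eis_norm_def algebra_simps, presburger)
  hence rot: "(y, - x - y) \<in> S r \<longleftrightarrow> (x, y) \<in> S r" "(- x - y, x) \<in> S r \<longleftrightarrow> (x, y) \<in> S r" for x y r
    by (simp_all only: S_def norm_sols_def mem_Collect_eq prod.case)
  have card_rot: "card A = card B"
    if "\<And>x y. (x, y) \<in> A \<Longrightarrow> (y, - x - y) \<in> B" "\<And>x y. (x, y) \<in> B \<Longrightarrow> (- x - y, x) \<in> A"
    for A B :: "(int \<times> int) set"
    by (rule bij_betw_same_card[of "\<lambda>(x, y). (y, - x - y)"], rule bij_betw_byWitness[of _ "\<lambda>(x, y). (- x - y, x)"])
       (auto intro: that)
  have "S 1 = C \<union> C' \<union> C''"
  proof (intro equalityI subsetI)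
    fix z assume z: "z \<in> S 1"
    obtain x y where xy: "z = (x, y)" by fastforce
    have "(x - y) mod 3 = 1" using z by (simp add: S_def xy)
    \<comment> \<open>Modulo 3 these forms equal x - y up to sign, so no point of \<open>S 1\<close>
      lies on a boundary line of the three cones.\<close>
    hence "2 * x + y \<noteq> 0" "x + 2 * y \<noteq> 0" "x - y \<noteq> 0" by presburger+
    hence "0 < 2 * x + y \<and> 0 < x + 2 * y \<or> x + 2 * y < 0 \<and> 0 < x - y \<or> 2 * x + y < 0 \<and> x - y < 0"
      by linarith
    thus "z \<in> C \<union> C' \<union> C''" using z by (auto simp: C_def C'_def C''_def xy)
  qed (use sub in auto)
  moreover have "C \<inter> C' = {}" "(C \<union> C') \<inter> C'' = {}" by (auto simp: C_def C'_def C''_def)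
  moreover have "card C = card C'"
    by (rule card_rot) (auto simp: C_def C'_def rot)
  moreover have "card C'' = card C"
    by (rule card_rot) (auto simp: C_def C''_def rot)
  moreover have "finite C" "finite C'" "finite C''" using sub fin finite_subset by blast+
  ultimately have 2: "card (S 1) = 3 * card C" by (simp add: card_Un_disjoint)
  \<comment> \<open>With (x, y) = f(a, b) one has x + 2y = 3a + 1 and 2x + y = 3b + 2, so the cone
    inequalities say exactly that a and b are nonnegative.\<close>
  define f where "f = (\<lambda>(a, b). (2 * int b - int a + 1, 2 * int a - int b))"
  have f_norm: "eis_norm (f (a, b)) = int (3 * m + 1) \<longleftrightarrow> (a, b) \<in> core_coords m" for a b
  proof -
    have "eis_norm (f (a, b)) = 3 * (int a * int a + int b * int b + int b - int a * int b) + 1"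
      by (simp add: eis_norm_def f_def algebra_simps)
    hence "eis_norm (f (a, b)) = int (3 * m + 1)
        \<longleftrightarrow> int a * int a + int b * int b + int b = int m + int a * int b" by auto
    also have "\<dots> \<longleftrightarrow> int (a * a + b * b + b) = int (m + a * b)" by simp
    finally show ?thesis unfolding core_coords_def by (simp only: of_nat_eq_iff) simp
  qed
  have "bij_betw f (core_coords m) C"
  proof (rule bij_betw_imageI)
    show "inj_on f (core_coords m)" by (rule inj_onI) (auto simp: f_def)
    show "f ` core_coords m = C"
    proof (intro equalityI subsetI)
      fix z assume "z \<in> f ` core_coords m"
      then obtain a b where ab: "z = f (a, b)" "(a, b) \<in> core_coords m" by auto
      have "(2 * int b - int a + 1 - (2 * int a - int b)) mod 3 = 1" by presburger
      thus "z \<in> C" using ab f_norm[of a b] by (auto simp: f_def C_def S_def norm_sols_def)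
    next
      fix z assume z: "z \<in> C"
      obtain x y where xy: "z = (x, y)" by fastforce
      have "(x - y) mod 3 = 1" and pos: "0 < 2 * x + y" "0 < x + 2 * y"
        using z by (auto simp: xy C_def S_def)
      then obtain k where k: "x = y + 3 * k + 1"
        by (metis add.commute add.left_commute diff_add_cancel mult_div_mod_eq)
      hence "z = f (nat (y + k), nat (y + 2 * k))" using pos by (simp add: f_def xy)
      moreover have "eis_norm z = int (3 * m + 1)" using z by (auto simp: C_def S_def norm_sols_def)
      ultimately show "z \<in> f ` core_coords m" using f_norm by auto
    qed
  qed
  hence "card (core_coords m) = card C" by (rule bij_betw_same_card)
  thus ?thesis using 1 2 by simp
qed

lemma card_core_coords_chi3: "int (card (core_coords m)) = (\<Sum>d | d dvd 3 * m + 1. chi3 d)"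
proof -
  have "\<not> 3 dvd 3 * m + 1" by presburger
  from card_norm_sols[OF this] show ?thesis unfolding card_core_coords by simp
qed

section \<open>The divisor-sum formula for \<open>A3\<close> and the recurrences\<close>

lemma A3_eq_divisor_sum: "3 * A3 n = (\<Sum>d | d dvd 3 * n + 2. d)"
proof -
  define s where "s k = (\<Sum>d | d dvd k. chi3 d)" for k
  define N where "N = 3 * n + 2"
  have "int (A3 n) = (\<Sum>i\<le>n. s (3 * i + 1) * s (3 * (n - i) + 1))"
    by (simp add: A3_convolution card_core_coords_chi3 s_def)
  also have "\<dots> = (\<Sum>i\<le>n. s (3 * i + 1) * s (N - (3 * i + 1)))"
  proof (rule sum.cong)
    fix i assume "i \<in> {..n}"
    hence "3 * (n - i) + 1 = N - (3 * i + 1)" by (simp add: N_def)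
    thus "s (3 * i + 1) * s (3 * (n - i) + 1) = s (3 * i + 1) * s (N - (3 * i + 1))" by metis
  qed simp
  also have "\<dots> = (\<Sum>A\<in>(\<lambda>i. 3 * i + 1) ` {..n}. s A * s (N - A))"
    by (subst sum.reindex) (auto simp: inj_on_def)
  \<comment> \<open>The missing A are 0 or 2 modulo 3. As N is 2 modulo 3, either N - A or A is then
    2 modulo 3, where s vanishes.\<close>
  also have "\<dots> = (\<Sum>A\<in>{1..<N}. s A * s (N - A))"
  proof (rule sum.mono_neutral_left)
    show "(\<lambda>i. 3 * i + 1) ` {..n} \<subseteq> {1..<N}" by (auto simp: N_def)
    show "\<forall>A\<in>{1..<N} - (\<lambda>i. 3 * i + 1) ` {..n}. s A * s (N - A) = 0"
    proof
      fix A assume A: "A \<in> {1..<N} - (\<lambda>i. 3 * i + 1) ` {..n}"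
      have mod_3: "(3 * j + 2) mod 3 = 2" for j :: nat by presburger
      have "A mod 3 = 2 \<or> (N - A) mod 3 = 2"
      proof (cases A rule: nat_mod_3_cases)
        case (1 i)
        hence "i \<le> n" using A by (simp add: N_def)
        hence "N - A = 3 * (n - i) + 2" unfolding N_def 1 by linarith
        hence "(N - A) mod 3 = 2" using mod_3[of "n - i"] by (simp only:)
        thus ?thesis ..
      next
        case (2 i)
        hence "i \<le> n" using A by (simp add: N_def)
        hence "A \<in> (\<lambda>i. 3 * i + 1) ` {..n}" unfolding 2 by (intro imageI) simp
        thus ?thesis using A by simp
      next
        case (3 i)
        hence "A mod 3 = 2" using mod_3[of i] by (simp only:)
        thus ?thesis ..
      qed
      thus "s A * s (N - A) = 0" using sum_chi3_divisors_eq_0 by (auto simp: s_def)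
    qed
  qed simp
  also have "\<dots> = (\<Sum>(a,x,b,y) \<in> quad_sols N. chi3 a * chi3 b)"
    unfolding s_def by (rule convolution_divisor_sums)
  finally have "int (3 * A3 n) = 3 * (\<Sum>(a,x,b,y) \<in> quad_sols N. chi3 a * chi3 b)" by simp
  also have "\<dots> = int (\<Sum>d | d dvd N. d)"
  proof (rule sum_quad_sols_chi3)
    show "N mod 3 = 2" unfolding N_def by presburger
  qed
  finally show ?thesis unfolding N_def by (simp only: of_nat_eq_iff)
qed

text \<open>As a sequence in k, s(p^k M) satisfies a linear recurrence of order two with
  characteristic roots 1 and p. The right-hand side solves it with the correct values at k = 0 and k
  = 1. It holds whether or not p divides M, because p always divides p^(k+1) M.\<close>

lemma divisor_sum_prime_power_mult:
  fixes p M k :: nat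
  assumes p: "prime p" and M: "M > 0"
  defines "s \<equiv> \<lambda>n. \<Sum>d | d dvd n. real d"
  shows "(real p - 1) * s (p ^ k * M) = (real p ^ k - 1) * s (p * M) - (real p ^ k - real p) * s M"
proof (induction k rule: induct_nat_012)
  case 0
  show ?case by (simp add: algebra_simps)
next
  case 1
  show ?case by simp
next
  case (ge2 k)
  have p0: "p > 0" using p prime_gt_0_nat by blast
  have "s (p * (p ^ Suc k * M)) = (1 + real p) * s (p ^ Suc k * M) - real p * s (p ^ k * M)"
    unfolding s_def using sum_divisors_prime_mult[of p "p ^ Suc k * M" real] p M p0 by simp
  hence rec: "s (p ^ Suc (Suc k) * M) = (1 + real p) * s (p ^ Suc k * M) - real p * s (p ^ k * M)"
    by (simp only: power_Suc[of p "Suc k"] mult.assoc)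
  have "(real p - 1) * s (p ^ Suc (Suc k) * M)
     = (1 + real p) * ((real p - 1) * s (p ^ Suc k * M)) - real p * ((real p - 1) * s (p ^ k * M))"
    unfolding rec by (simp add: algebra_simps)
  also have "\<dots> = (real p ^ Suc (Suc k) - 1) * s (p * M) - (real p ^ Suc (Suc k) - real p) * s M"
    unfolding ge2.IH by (simp add: algebra_simps)
  finally show ?case .
qed

text \<open>The shift is chosen so that 3(qn + (2q - 2)/3) + 2 = q(3n + 2); the hypothesis on q
  makes the division exact.\<close>

lemma A3_scaled:
  assumes "q mod 3 = 1"
  shows "3 * real (A3 (q * n + (2 * q - 2) div 3)) = (\<Sum>d | d dvd q * (3 * n + 2). real d)"
proof -
  obtain r where q: "q = 3 * r + 1"
    using assms mult_div_mod_eq[of 3 q] by metis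
  have "(2 * q - 2) div 3 = 2 * r" by (simp add: q)
  hence "3 * (q * n + (2 * q - 2) div 3) + 2 = q * (3 * n + 2)" by (simp add: q algebra_simps)
  with A3_eq_divisor_sum[of "q * n + (2 * q - 2) div 3"]
  have "real (3 * A3 (q * n + (2 * q - 2) div 3)) = real (\<Sum>d | d dvd q * (3 * n + 2). d)" by metis
  thus ?thesis by simp
qed

theorem theorem2p3:
  fixes p k n :: nat
  assumes "prime p"
  shows "(p mod 3 = 1 \<longrightarrow>
            real (A3 (p ^ k * n + (2 * p ^ k - 2) div 3)) =
              (real p ^ k - 1) / (real p - 1) * real (A3 (p * n + (2 * p - 2) div 3))
              - (real p ^ k - real p) / (real p - 1) * real (A3 n))
       \<and> (p mod 3 = 2 \<longrightarrow>
            real (A3 (p ^ (2 * k) * n + (2 * p ^ (2 * k) - 2) div 3)) =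
              (real p ^ (2 * k) - 1) / (real p ^ 2 - 1) * real (A3 (p ^ 2 * n + (2 * p ^ 2 - 2) div 3))
              - (real p ^ (2 * k) - real p ^ 2) / (real p ^ 2 - 1) * real (A3 n))"
proof -
  define s where "s m = (\<Sum>d | d dvd m. real d)" for m :: nat
  let ?M = "3 * n + 2"
  have p1: "real p > 1" using prime_gt_1_nat[OF assms] by simp
  hence p2: "real p ^ 2 > 1" by (simp add: power_gt1)
  have A: "real (A3 (q * n + (2 * q - 2) div 3)) = s (q * ?M) / 3" if "q mod 3 = 1" for q
    using A3_scaled[OF that, of n] by (simp add: s_def)
  have A1: "real (A3 n) = s ?M / 3" using A[of 1] by simp
  have S: "(real p - 1) * s (p ^ j * ?M) = (real p ^ j - 1) * s (p * ?M) - (real p ^ j - real p) * s ?M" for j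
    unfolding s_def by (rule divisor_sum_prime_power_mult[OF assms]) simp
  have D: "(a * u - b * v) / c / 3 = a / c * (u / 3) - b / c * (v / 3)" for a b c u v :: real
    by (simp add: diff_divide_distrib)
  show ?thesis
  proof (intro conjI impI)
    assume p3: "p mod 3 = 1"
    hence "p ^ k mod 3 = 1" using power_mod[of p 3 k] by simp
    moreover have "s (p ^ k * ?M) = ((real p ^ k - 1) * s (p * ?M) - (real p ^ k - real p) * s ?M) / (real p - 1)"
      using S[of k] p1 by (simp add: field_simps)
    ultimately show "real (A3 (p ^ k * n + (2 * p ^ k - 2) div 3)) =
              (real p ^ k - 1) / (real p - 1) * real (A3 (p * n + (2 * p - 2) div 3))
              - (real p ^ k - real p) / (real p - 1) * real (A3 n)"
      by (simp only: A1 A[OF p3] A D)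
  next
    assume p3: "p mod 3 = 2"
    have q3: "p ^ 2 mod 3 = 1" using p3 power_mod[of p 3 2] by simp
    hence "p ^ (2 * k) mod 3 = 1" using power_mod[of "p ^ 2" 3 k] by (simp add: power_mult)
    moreover have "s (p ^ (2 * k) * ?M)
       = ((real p ^ (2 * k) - 1) * s (p ^ 2 * ?M) - (real p ^ (2 * k) - real p ^ 2) * s ?M) / (real p ^ 2 - 1)"
    proof -
      define P u v where "P = real p" and "u = s (p * ?M)" and "v = s ?M"
      define x y where "x = s (p ^ (2 * k) * ?M)" and "y = s (p ^ 2 * ?M)"
      define Q where "Q = P ^ (2 * k)"
      have x: "(P - 1) * x = (Q - 1) * u - (Q - P) * v" and y: "(P - 1) * y = (P ^ 2 - 1) * u - (P ^ 2 - P) * v"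
        using S[of "2 * k"] S[of 2] by (simp_all only: P_def u_def v_def x_def y_def Q_def)
      \<comment> \<open>The value u at pM does not occur in the claim for p^2. It is eliminated
        between the identities for the exponents 2k and 2, after which P - 1 cancels.\<close>
      have "(P - 1) * ((P ^ 2 - 1) * x) = (P - 1) * ((Q - 1) * y - (Q - P ^ 2) * v)"
      proof -
        have "(P - 1) * ((P ^ 2 - 1) * x) = (P ^ 2 - 1) * ((P - 1) * x)" by simp
        also have "\<dots> = (Q - 1) * ((P - 1) * y) - (P - 1) * ((Q - P ^ 2) * v)"
          unfolding x y by (simp add: algebra_simps power2_eq_square)
        finally show ?thesis by (simp add: algebra_simps)
      qed
      hence "(P ^ 2 - 1) * x = (Q - 1) * y - (Q - P ^ 2) * v" using p1 by (simp add: P_def)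
      hence "x = ((Q - 1) * y - (Q - P ^ 2) * v) / (P ^ 2 - 1)" using p2 by (simp add: P_def field_simps)
      thus ?thesis by (simp only: P_def u_def v_def x_def y_def Q_def)
    qed
    ultimately show "real (A3 (p ^ (2 * k) * n + (2 * p ^ (2 * k) - 2) div 3)) =
              (real p ^ (2 * k) - 1) / (real p ^ 2 - 1) * real (A3 (p ^ 2 * n + (2 * p ^ 2 - 2) div 3))
              - (real p ^ (2 * k) - real p ^ 2) / (real p ^ 2 - 1) * real (A3 n)"
      by (simp only: A1 A[OF q3] A D)
  qed
qed

end
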